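(* Let $V$ be a valuation domain of rank one with quotient field $K$ and value group $\Gamma_v\subseteq\mathbb{R}$. For $\delta\in\mathbb{R}$ let $\mathcal{V}_{\mathrm{div}}(\bullet,\delta)=\{V_E\mid E\text{ is a pseudo-divergent sequence in }K\text{ with }\delta_E=\delta\}$. Then: (a) if $\delta\notin\Gamma_v$, then $\mathcal{V}_{\mathrm{div}}(\bullet,\delta)=\mathcal{V}_K(\bullet,\delta)$; (b) if $\delta\in\Gamma_v$ and the residue field of $V$ is finite, then $\mathcal{V}_{\mathrm{div}}(\bullet,\delta)$ is discrete (with respect to the Zariski and the constructible topology); (c) if $\delta\in\Gamma_v$ and the residue field of $V$ is infinite, then $\mathcal{V}_{\mathrm{div}}(\bullet,\delta)$ is not Hausdorff (with respect to the Zariski topology). In particular, if the residue field of $V$ is infinite then $\mathcal{V}_{\mathrm{div}}$ is not Hausdorff, with respect to the Zariski topology.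
   Context: $\mathrm{Zar}(K(X)|V)$ is the set of valuation domains of $K(X)$ (with quotient field $K(X)$) containing $V$. Its Zariski topology is generated by the subbasic open sets $B(\phi)=\{W\mid\phi\in W\}$, $\phi\in K(X)$; its constructible topology is the coarsest topology for which all sets $B(\phi_1)\cap\cdots\cap B(\phi_k)$ are both open and closed. Subsets carry the subspace topologies. $v$ is the valuation associated to $V$. A sequence $E=\{s_n\}_{n\in\mathbb{N}}$ in $K$ is pseudo-convergent if $v(s_{n+1}-s_n)<v(s_{n+2}-s_{n+1})$ for all $n$, and pseudo-divergent if $v(s_n-s_{n+1})>v(s_{n+1}-s_{n+2})$ for all $n$. In both cases its breadth is $\delta_E=\lim_{n\to\infty}v(s_{n+1}-s_n)\in\mathbb{R}\cup\{\pm\infty\}$, and $V_E=\{\phi\in K(X)\mid\phi(s_n)\in V\text{ for all but finitely many }n\in\mathbb{N}\}$ is a valuation domain of $K(X)$ extending $V$. An element $\alpha\in K$ is a pseudo-limit of a pseudo-convergent sequence $E$ if $v(\alpha-s_n)<v(\alpha-s_{n+1})$ for all $n$. $\mathcal{V}_K(\bullet,\delta)$ is the set of rings $V_E$ with $E$ a pseudo-convergent sequence in $K$ of breadth $\delta$ having a pseudo-limit in $K$. $\mathcal{V}_{\mathrm{div}}$ is the set of all rings $V_E$, with $E$ a pseudo-divergent sequence in $K$.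
   Formalization: (a) is restricted to δ outside the divisible hull of Γ_v unless Γ_v is discrete (the two sets are otherwise nonempty and disjoint); (c) and the final claim assume Γ_v is not discrete (for a DVR the space is empty, respectively a single point, hence Hausdorff). *)

theory Defs
  imports "HOL-Analysis.Analysis" "HOL-Computational_Algebra.Computational_Algebra"
begin

section \<open>Valuation domains of a field\<close>

text \<open>A valuation domain whose quotient field is the whole field \<open>'f\<close>.  The quotient field
  condition is not listed, because it follows from the last clause.\<close>

definition valuation_domain :: "'f::field set \<Rightarrow> bool" where
  "valuation_domain W \<longleftrightarrow>
     0 \<in> W \<and> 1 \<in> W \<and> (\<forall>x\<in>W. \<forall>y\<in>W. x - y \<in> W \<and> x * y \<in> W) \<and>
     (\<forall>x. x \<noteq> 0 \<longrightarrow> x \<in> W \<or> inverse x \<in> W)"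

definition prime_ideal_of :: "'f::field set \<Rightarrow> 'f set \<Rightarrow> bool" where
  "prime_ideal_of W P \<longleftrightarrow>
     P \<subseteq> W \<and> 0 \<in> P \<and> (\<forall>x\<in>P. \<forall>y\<in>P. x + y \<in> P) \<and> (\<forall>w\<in>W. \<forall>x\<in>P. w * x \<in> P) \<and>
     1 \<notin> P \<and> (\<forall>x\<in>W. \<forall>y\<in>W. x * y \<in> P \<longrightarrow> x \<in> P \<or> y \<in> P)"

text \<open>The rank of a valuation domain is its Krull dimension; the prime ideals form a chain, so
  rank one means that there is exactly one nonzero prime ideal.\<close>

definition rank_one :: "'f::field set \<Rightarrow> bool" where
  "rank_one W \<longleftrightarrow> (\<exists>!P. prime_ideal_of W P \<and> P \<noteq> {0})"

definition maximal_ideal :: "'f::field set \<Rightarrow> 'f set" where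
  "maximal_ideal W = {x \<in> W. x = 0 \<or> inverse x \<notin> W}"

definition residue_field :: "'f::field set \<Rightarrow> 'f set set" where
  "residue_field W = W // {(x, y). x \<in> W \<and> y \<in> W \<and> x - y \<in> maximal_ideal W}"

text \<open>\<open>v\<close> is a valuation associated to \<open>V\<close> whose value group is realised inside the reals.\<close>

definition associated_valuation :: "'k::field set \<Rightarrow> ('k \<Rightarrow> ereal) \<Rightarrow> bool" where
  "associated_valuation V v \<longleftrightarrow>
     (\<forall>x. v x \<noteq> -\<infinity>) \<and> (\<forall>x. v x = \<infinity> \<longleftrightarrow> x = 0) \<and>
     (\<forall>x y. v (x * y) = v x + v y) \<and> (\<forall>x y. min (v x) (v y) \<le> v (x + y)) \<and>
     V = {x. 0 \<le> v x}"

definition value_group :: "('k::field \<Rightarrow> ereal) \<Rightarrow> real set" where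
  "value_group v = {r. \<exists>x. v x = ereal r}"

definition discrete_value_group :: "('k::field \<Rightarrow> ereal) \<Rightarrow> bool" where
  "discrete_value_group v \<longleftrightarrow> (\<exists>g. value_group v = range (\<lambda>k::int. of_int k * g))"

text \<open>The divisible hull \<open>\<rat>\<Gamma>\<^sub>v\<close> of the value group.\<close>

definition divisible_hull :: "('k::field \<Rightarrow> ereal) \<Rightarrow> real set" where
  "divisible_hull v = {r. \<exists>m::nat. m > 0 \<and> of_nat m * r \<in> value_group v}"


section \<open>Spaces of valuation domains of the field of rational functions\<close>

text \<open>\<open>'k poly fract\<close> is the field \<open>K(X)\<close>, in which \<open>K\<close> sits as \<open>\<lambda>c. to_fract [:c:]\<close>.\<close>

definition Zar :: "'k::field set \<Rightarrow> 'k poly fract set set" where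
  "Zar V = {W. valuation_domain W \<and> (\<lambda>c. to_fract [:c:]) ` V \<subseteq> W}"

definition zariski_topology :: "'k::field set \<Rightarrow> 'k poly fract set topology" where
  "zariski_topology V = topology_generated_by {{W \<in> Zar V. \<phi> \<in> W} |\<phi>. True}"

text \<open>The finite set \<open>F\<close> is \<open>{\<phi>\<^sub>1, \<dots>, \<phi>\<^sub>k}\<close>, so that \<open>{W \<in> Zar V. F \<subseteq> W}\<close> is
  \<open>B(\<phi>\<^sub>1) \<inter> \<dots> \<inter> B(\<phi>\<^sub>k)\<close>.\<close>

definition constructible_topology :: "'k::field set \<Rightarrow> 'k poly fract set topology" where
  "constructible_topology V = topology_generated_by
     ({{W \<in> Zar V. F \<subseteq> W} |F. finite F} \<union> {Zar V - {W \<in> Zar V. F \<subseteq> W} |F. finite F})"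


section \<open>Pseudo-convergent and pseudo-divergent sequences\<close>

text \<open>The value of \<open>\<phi>\<close> at \<open>a\<close> exists if \<open>\<phi>\<close> has some representation as a fraction whose
  denominator does not vanish at \<open>a\<close>; it is then unique.\<close>

definition has_value_at :: "'k::field poly fract \<Rightarrow> 'k \<Rightarrow> 'k \<Rightarrow> bool" where
  "has_value_at \<phi> a y \<longleftrightarrow> (\<exists>p q. \<phi> = Fract p q \<and> poly q a \<noteq> 0 \<and> y = poly p a / poly q a)"

lemma has_value_at_unique:
  assumes "has_value_at \<phi> a y" "has_value_at \<phi> a z"
  shows "y = z"
proof -
  obtain p q where pq: "\<phi> = Fract p q" "poly q a \<noteq> 0" "y = poly p a / poly q a"
    using assms(1) by (auto simp: has_value_at_def)
  obtain p' q' where pq': "\<phi> = Fract p' q'" "poly q' a \<noteq> 0" "z = poly p' a / poly q' a"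
    using assms(2) by (auto simp: has_value_at_def)
  have "q \<noteq> 0" "q' \<noteq> 0" using pq(2) pq'(2) by auto
  hence "p * q' = p' * q" using pq(1) pq'(1) by (simp add: eq_fract)
  hence "poly p a * poly q' a = poly p' a * poly q a" by (metis poly_mult)
  thus ?thesis using pq pq' by (simp add: frac_eq_eq)
qed

definition pseudo_convergent :: "('k::field \<Rightarrow> ereal) \<Rightarrow> (nat \<Rightarrow> 'k) \<Rightarrow> bool" where
  "pseudo_convergent v s \<longleftrightarrow> (\<forall>n. v (s (n+1) - s n) < v (s (n+2) - s (n+1)))"

definition pseudo_divergent :: "('k::field \<Rightarrow> ereal) \<Rightarrow> (nat \<Rightarrow> 'k) \<Rightarrow> bool" where
  "pseudo_divergent v s \<longleftrightarrow> (\<forall>n. v (s n - s (n+1)) > v (s (n+1) - s (n+2)))"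

definition breadth :: "('k::field \<Rightarrow> ereal) \<Rightarrow> (nat \<Rightarrow> 'k) \<Rightarrow> ereal" where
  "breadth v s = lim (\<lambda>n. v (s (n+1) - s n))"

definition pseudo_limit :: "('k::field \<Rightarrow> ereal) \<Rightarrow> (nat \<Rightarrow> 'k) \<Rightarrow> 'k \<Rightarrow> bool" where
  "pseudo_limit v s \<alpha> \<longleftrightarrow> (\<forall>n. v (\<alpha> - s n) < v (\<alpha> - s (n+1)))"

definition seq_domain :: "'k::field set \<Rightarrow> (nat \<Rightarrow> 'k) \<Rightarrow> 'k poly fract set" where
  "seq_domain V s = {\<phi>. eventually (\<lambda>n. \<exists>y\<in>V. has_value_at \<phi> (s n) y) sequentially}"

definition V_K_breadth ::
    "'k::field set \<Rightarrow> ('k \<Rightarrow> ereal) \<Rightarrow> real \<Rightarrow> 'k poly fract set set" where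
  "V_K_breadth V v \<delta> =
     {seq_domain V s |s. pseudo_convergent v s \<and> breadth v s = ereal \<delta> \<and> (\<exists>\<alpha>. pseudo_limit v s \<alpha>)}"

definition V_div_breadth ::
    "'k::field set \<Rightarrow> ('k \<Rightarrow> ereal) \<Rightarrow> real \<Rightarrow> 'k poly fract set set" where
  "V_div_breadth V v \<delta> = {seq_domain V s |s. pseudo_divergent v s \<and> breadth v s = ereal \<delta>}"

definition V_div :: "'k::field set \<Rightarrow> ('k \<Rightarrow> ereal) \<Rightarrow> 'k poly fract set set" where
  "V_div V v = {seq_domain V s |s. pseudo_divergent v s}"


section \<open>Two degenerate situations\<close>

text \<open>If the value group is discrete, there are no pseudo-divergent sequences of real breadth, so
  that \<open>V_div_breadth V v \<delta>\<close> is empty and trivially Hausdorff.  If \<open>\<delta>\<close> lies in the divisible hull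
  of the value group, whether or not in the value group itself, then \<open>V_div_breadth V v \<delta>\<close> and
  \<open>V_K_breadth V v \<delta>\<close> are disjoint, so that they can only be equal by being empty.\<close>

lemma associated_valuation_minus:
  assumes "associated_valuation V v"
  shows "v (- x) = v x"
proof -
  have m: "v (x * y) = v x + v y" for x y
    using assms by (auto simp: associated_valuation_def)
  have fin: "v (-1) \<noteq> \<infinity>" "v (-1) \<noteq> -\<infinity>" "v 1 \<noteq> \<infinity>" "v 1 \<noteq> -\<infinity>"
    using assms by (auto simp: associated_valuation_def)
  have "v 1 = v 1 + v 1" using m[of 1 1] by simp
  moreover have "v 1 = v (-1) + v (-1)" using m[of "-1" "-1"] by simp
  ultimately have "v (-1) = 0" using fin
    by (cases "v 1"; cases "v (-1)") (auto simp: zero_ereal_def)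
  thus ?thesis using m[of "-1" x] by simp
qed

lemma V_div_breadth_discrete:
  assumes "associated_valuation V v" "discrete_value_group v"
  shows "V_div_breadth V v \<delta> = {}"
proof (rule ccontr)
  assume "V_div_breadth V v \<delta> \<noteq> {}"
  then obtain s where s: "pseudo_divergent v s" "breadth v s = ereal \<delta>"
    by (auto simp: V_div_breadth_def)
  define d where "d = (\<lambda>n. v (s (n+1) - s n))"
  have d: "d n = v (s n - s (n+1))" for n
    using associated_valuation_minus[OF assms(1), of "s n - s (n+1)"] by (simp add: d_def)
  have dec: "d (Suc n) < d n" for n
    using s(1) unfolding pseudo_divergent_def d by (simp add: numeral_2_eq_2)
  obtain g where g: "value_group v = range (\<lambda>k::int. of_int k * g)"
    using assms(2) by (auto simp: discrete_value_group_def)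
  have fin: "d (Suc n) \<noteq> -\<infinity>" "d (Suc n) \<noteq> \<infinity>" for n
    using assms(1) dec[of n] unfolding associated_valuation_def d_def
    by (blast, metis ereal_infty_less(1) less_irrefl order_less_le_trans ereal_less_eq(1))
  have "\<exists>k::int. d (Suc n) = ereal (of_int k * g)" for n
  proof -
    obtain r where r: "d (Suc n) = ereal r" using fin[of n] by (cases "d (Suc n)") auto
    hence "r \<in> value_group v" by (auto simp: value_group_def d_def)
    thus ?thesis using r g by auto
  qed
  then obtain k :: "nat \<Rightarrow> int" where k: "\<And>n. d (Suc n) = ereal (of_int (k n) * g)" by metis
  have "decseq d" using dec by (intro decseq_SucI) (simp add: less_imp_le)
  hence "d \<longlonglongrightarrow> (INF n. d n)" by (rule LIMSEQ_INF)
  moreover have "lim d = ereal \<delta>" using s(2) by (simp add: breadth_def d_def)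
  ultimately have "d \<longlonglongrightarrow> ereal \<delta>" using limI by metis
  hence "(\<lambda>n. d (Suc n)) \<longlonglongrightarrow> ereal \<delta>" by (rule LIMSEQ_Suc)
  hence lim: "(\<lambda>n. of_int (k n) * g) \<longlonglongrightarrow> \<delta>" unfolding k by simp
  have kdec: "of_int (k (Suc n)) * g < of_int (k n) * g" for n
    using dec[of "Suc n"] k[of n] k[of "Suc n"] by simp
  hence "k (Suc 0) \<noteq> k 0" "g \<noteq> 0" by (metis less_irrefl, metis less_irrefl mult_zero_right)
  have "Cauchy (\<lambda>n. of_int (k n) * g)" using lim LIMSEQ_imp_Cauchy by blast
  then obtain M where "\<And>m n. m \<ge> M \<Longrightarrow> n \<ge> M \<Longrightarrow> dist (of_int (k m) * g) (of_int (k n) * g) < \<bar>g\<bar>"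
    using \<open>g \<noteq> 0\<close> unfolding Cauchy_def by (meson zero_less_abs_iff)
  from this[of "Suc M" M] have "\<bar>of_int (k (Suc M) - k M) * g\<bar> < \<bar>g\<bar>"
    by (simp add: dist_real_def algebra_simps)
  hence "\<bar>of_int (k (Suc M) - k M) :: real\<bar> < 1" using \<open>g \<noteq> 0\<close> by (simp add: abs_mult)
  hence "k (Suc M) = k M" by linarith
  thus False using kdec[of M] by simp
qed

lemma V_div_breadth_divisible_hull:
  assumes "associated_valuation V v" "\<delta> \<in> divisible_hull v"
  shows "V_div_breadth V v \<delta> \<inter> V_K_breadth V v \<delta> = {}"
proof (rule ccontr)
  assume "V_div_breadth V v \<delta> \<inter> V_K_breadth V v \<delta> \<noteq> {}"
  then obtain s t \<alpha> where s: "pseudo_divergent v s" "breadth v s = ereal \<delta>"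
    and t: "pseudo_convergent v t" "breadth v t = ereal \<delta>" "pseudo_limit v t \<alpha>"
    and eq: "seq_domain V s = seq_domain V t"
    by (force simp: V_div_breadth_def V_K_breadth_def)
  have vm: "v (x * y) = v x + v y" and va: "min (v x) (v y) \<le> v (x + y)" and vV: "V = {x. 0 \<le> v x}"
    and vi: "v x = \<infinity> \<longleftrightarrow> x = 0" and vn: "v x \<noteq> -\<infinity>" for x y
    using assms(1) by (auto simp: associated_valuation_def)
  note vneg = associated_valuation_minus[OF assms(1)]
  have vmi: "v (x - y) = v (y - x)" for x y using vneg[of "x - y"] by simp
  obtain m c where m: "m > 0" and c: "v c = ereal (of_nat m * \<delta>)"
    using assms(2) by (auto simp: divisible_hull_def value_group_def)
  have c0: "c \<noteq> 0" using c vi[of c] by auto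
  define a where "a = s 0"
  define d where "d = (\<lambda>n. v (s (n+1) - s n))"
  have dec: "d (Suc n) < d n" for n
    using s(1) unfolding pseudo_divergent_def d_def
    by (simp add: vmi numeral_2_eq_2)
  have "decseq d" using dec by (intro decseq_SucI) (simp add: less_imp_le)
  hence "d \<longlonglongrightarrow> (INF n. d n)" by (rule LIMSEQ_INF)
  moreover have "lim d = ereal \<delta>" using s(2) by (simp add: breadth_def d_def)
  ultimately have "(INF n. d n) = ereal \<delta>" using limI by metis
  hence dge: "d n \<ge> ereal \<delta>" for n by (metis INF_lower UNIV_I)
  have sa: "v (s n - a) \<ge> ereal \<delta>" for n
  proof (induction n)
    case 0 show ?case using vi[of 0] by (simp add: a_def)
  next
    case (Suc n)
    show ?case using va[of "s (Suc n) - s n" "s n - a"] Suc dge[of n] by (auto simp: d_def min_def split: if_splits)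
  qed
  define e where "e = (\<lambda>n. v (t (n+1) - t n))"
  have inc: "e n < e (Suc n)" for n
    using t(1) unfolding pseudo_convergent_def e_def by (simp add: numeral_2_eq_2)
  have "incseq e" using inc by (intro incseq_SucI) (simp add: less_imp_le)
  hence "e \<longlonglongrightarrow> (SUP n. e n)" by (rule LIMSEQ_SUP)
  moreover have "lim e = ereal \<delta>" using t(2) by (simp add: breadth_def e_def)
  ultimately have esup: "(SUP n. e n) = ereal \<delta>" using limI by metis
  hence "e n \<le> ereal \<delta>" for n by (metis SUP_upper UNIV_I)
  hence elt: "e n < ereal \<delta>" for n using inc[of n] by (metis order_less_le_trans)
  have et: "v (\<alpha> - t n) = e n" for n
  proof -
    have lt: "v (\<alpha> - t n) < v (\<alpha> - t (n+1))" using t(3) by (auto simp: pseudo_limit_def)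
    have 1: "v (\<alpha> - t n) \<le> e n"
      using va[of "\<alpha> - t n" "- (\<alpha> - t (n+1))"] vneg[of "\<alpha> - t (n+1)"] lt
      by (auto simp: e_def min_def split: if_splits)
    have 2: "min (v (\<alpha> - t (n+1))) (e n) \<le> v (\<alpha> - t n)"
      using va[of "\<alpha> - t (n+1)" "t (n+1) - t n"] by (simp add: e_def)
    show ?thesis using 1 2 lt by (auto simp: min_def split: if_splits)
  qed
  have vpow: "v (x ^ m) = ereal (of_nat m) * v x" if "m > 0" for x m
    using that
  proof (induction m)
    case (Suc m)
    show ?case
    proof (cases "m = 0")
      case False
      thus ?thesis using Suc by (cases "v x") (auto simp: vm algebra_simps)
    qed auto
  qed auto
  define \<phi> where "\<phi> = Fract ([:-a, 1:] ^ m) [:c:]"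
  have ev: "has_value_at \<phi> x ((x - a) ^ m / c)" for x
    unfolding has_value_at_def \<phi>_def using c0 
    by (intro exI[of _ "[:-a, 1:] ^ m"] exI[of _ "[:c:]"]) simp
  have iff: "(x - a) ^ m / c \<in> V \<longleftrightarrow> v (x - a) \<ge> ereal \<delta>" for x
  proof -
    have "v ((x - a) ^ m) = v ((x - a) ^ m / c) + ereal (of_nat m * \<delta>)"
      using vm[of "(x - a) ^ m / c" c] c c0 by simp
    hence "ereal (of_nat m) * v (x - a) = v ((x - a) ^ m / c) + ereal (of_nat m * \<delta>)"
      using vpow[OF m] by simp
    moreover have "0 \<le> b \<longleftrightarrow> \<delta> \<le> r" if "r * real m = b + \<delta> * real m" for r b
    proof -
      have "\<delta> \<le> r \<longleftrightarrow> \<delta> * real m \<le> r * real m" using m by simp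
      thus ?thesis using that by linarith
    qed
    ultimately show ?thesis using m vn[of "x - a"] vn[of "(x - a) ^ m / c"] unfolding vV
      by (cases "v (x - a)"; cases "v ((x - a) ^ m / c)") (auto simp: algebra_simps)
  qed
  have "\<phi> \<in> seq_domain V s"
    unfolding seq_domain_def using ev iff sa by (auto intro!: always_eventually)
  hence "\<forall>\<^sub>F n in sequentially. \<exists>y\<in>V. has_value_at \<phi> (t n) y"
    unfolding eq unfolding seq_domain_def by simp
  then obtain N where N: "\<And>n. n \<ge> N \<Longrightarrow> v (t n - a) \<ge> ereal \<delta>"
    unfolding eventually_sequentially using ev iff has_value_at_unique by metis
  have "e n \<le> v (\<alpha> - a)" if "n \<ge> N" for n
    using va[of "\<alpha> - t n" "t n - a"] et[of n] N[OF that] elt[of n]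
    by (auto simp: min_def split: if_splits)
  hence "e n \<le> v (\<alpha> - a)" for n
    using \<open>incseq e\<close> by (meson incseqD max.cobounded1 max.cobounded2 order_trans)
  hence "ereal \<delta> \<le> v (\<alpha> - a)" using esup by (metis SUP_least)
  hence "ereal \<delta> \<le> v (\<alpha> - t N)"
    using va[of "\<alpha> - a" "- (t N - a)"] vneg[of "t N - a"] N[of N]
    by (auto simp: min_def split: if_splits)
  thus False using et elt[of N] by simp
qed

end

theory Submission
  imports Defs
begin

text \<open>As \<open>v (x - a)\<close> tends to \<open>\<delta>\<close> from above, one term of a polynomial in \<open>x - a\<close> eventually
  dominates all others, so whether \<open>\<phi> x\<close> lies in \<open>V\<close> is eventually decided. Hence the ring of a
  pseudo-divergent sequence \<open>s\<close> of breadth \<open>\<delta>\<close> depends only on the open ball of radius \<open>\<delta>\<close> around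
  \<open>s 0\<close>. If \<open>\<delta>\<close> is not in the divisible hull of the value group, \<open>v (x - a)\<close> may approach \<open>\<delta>\<close> from
  either side with the same outcome, so that pseudo-convergent sequences give the same rings. If
  \<open>\<delta> = v c\<close>, the open balls inside the closed ball of radius \<open>\<delta>\<close> around \<open>a\<close> correspond to the
  residue classes. When these are finitely many, finitely many linear fractions single out one of
  them. When they are infinitely many, a rational function in the ring of one ball has nonnegative
  Gauss valuation and therefore lies in the rings of all but finitely many balls; thus any two
  neighbourhoods meet.\<close>

section \<open>Values of rational functions at points\<close>

lemma has_value_at_Fract: "poly q x \<noteq> 0 \<Longrightarrow> has_value_at (Fract p q) x (poly p x / poly q x)"
  by (auto simp: has_value_at_def)

lemma has_value_at_Bex_iff:
  "has_value_at \<phi> x y \<Longrightarrow> (\<exists>z\<in>A. has_value_at \<phi> x z) \<longleftrightarrow> y \<in> A"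
  using has_value_at_unique by blast

lemma has_value_at_const: "has_value_at (to_fract [:c:]) x c"
  unfolding has_value_at_def to_fract_def by (intro exI[of _ "[:c:]"] exI[of _ 1]) simp

lemma has_value_at_diff:
  assumes "has_value_at \<phi> x y" "has_value_at \<psi> x z"
  shows "has_value_at (\<phi> - \<psi>) x (y - z)"
proof -
  obtain p q where pq: "\<phi> = Fract p q" "poly q x \<noteq> 0" "y = poly p x / poly q x"
    using assms(1) by (auto simp: has_value_at_def)
  obtain p' q' where pq': "\<psi> = Fract p' q'" "poly q' x \<noteq> 0" "z = poly p' x / poly q' x"
    using assms(2) by (auto simp: has_value_at_def)
  have "q \<noteq> 0" "q' \<noteq> 0" using pq pq' by auto
  then have "\<phi> - \<psi> = Fract (p * q' - p' * q) (q * q')" by (simp add: pq pq')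
  moreover have "y - z = poly (p * q' - p' * q) x / poly (q * q') x"
    using pq pq' by (simp add: diff_frac_eq)
  ultimately show ?thesis using pq pq' unfolding has_value_at_def
    by (metis poly_mult mult_eq_0_iff)
qed

lemma has_value_at_mult:
  assumes "has_value_at \<phi> x y" "has_value_at \<psi> x z"
  shows "has_value_at (\<phi> * \<psi>) x (y * z)"
proof -
  obtain p q where pq: "\<phi> = Fract p q" "poly q x \<noteq> 0" "y = poly p x / poly q x"
    using assms(1) by (auto simp: has_value_at_def)
  obtain p' q' where pq': "\<psi> = Fract p' q'" "poly q' x \<noteq> 0" "z = poly p' x / poly q' x"
    using assms(2) by (auto simp: has_value_at_def)
  show ?thesis unfolding has_value_at_def using pq pq'
    by (intro exI[of _ "p * p'"] exI[of _ "q * q'"]) simp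
qed

lemma has_value_at_inverse:
  assumes "has_value_at \<phi> x y" "y \<noteq> 0"
  shows "has_value_at (inverse \<phi>) x (inverse y)"
proof -
  obtain p q where pq: "\<phi> = Fract p q" "poly q x \<noteq> 0" "y = poly p x / poly q x"
    using assms(1) by (auto simp: has_value_at_def)
  show ?thesis unfolding has_value_at_def using pq assms(2)
    by (intro exI[of _ q] exI[of _ p]) simp
qed

text \<open>Cross multiplication with the representation that witnesses the value gives the equation
  even where \<open>q\<close> vanishes at \<open>x\<close>. At a zero of \<open>q\<close> that is
  not a zero of \<open>p\<close> it shows that no value exists.\<close>

lemma has_value_at_FractD:
  assumes "has_value_at (Fract p q) x y" "q \<noteq> 0"
  shows "poly p x = y * poly q x"
proof -
  obtain p' q' where pq': "Fract p q = Fract p' q'" "poly q' x \<noteq> 0" "y = poly p' x / poly q' x"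
    using assms(1) by (auto simp: has_value_at_def)
  then have "p * q' = p' * q" using assms(2) by (metis eq_fract(1) poly_0)
  then have "poly p x * poly q' x = poly p' x * poly q x" by (metis poly_mult)
  also have "\<dots> = y * poly q x * poly q' x" using pq' by simp
  finally show ?thesis using pq'(2) by simp
qed

section \<open>Subgroups of the real line\<close>

text \<open>Distinct elements are at least \<epsilon> apart, so the infimum of the positive elements
  is attained; division with remainder by it then reaches every element.\<close>

lemma real_subgroup_cyclic:
  fixes G :: "real set"
  assumes zero: "0 \<in> G" and diff: "\<And>x y. x \<in> G \<Longrightarrow> y \<in> G \<Longrightarrow> x - y \<in> G"
    and "\<epsilon> > 0" and gap: "\<And>x. x \<in> G \<Longrightarrow> 0 < x \<Longrightarrow> \<epsilon> \<le> x"
  shows "\<exists>g. G = range (\<lambda>k::int. of_int k * g)"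
proof (cases "G = {0}")
  case True
  then show ?thesis by (intro exI[of _ 0]) auto
next
  case False
  have neg: "- x \<in> G" if "x \<in> G" for x using diff[OF zero that] by simp
  have add: "x + y \<in> G" if "x \<in> G" "y \<in> G" for x y using diff[OF that(1) neg[OF that(2)]] by simp
  have nat: "of_nat k * x \<in> G" if "x \<in> G" for k x
    by (induction k) (auto simp: zero algebra_simps intro: add that)
  have int: "of_int k * x \<in> G" if "x \<in> G" for k :: int and x
    by (cases k rule: int_cases2) (use nat[OF that] neg[OF nat[OF that]] in auto)
  define P where "P = {x \<in> G. 0 < x}"
  have ne: "P \<noteq> {}"
  proof -
    obtain x where "x \<in> G" "x \<noteq> 0" using False zero by auto
    then have "x \<in> P \<or> - x \<in> P" using neg by (auto simp: P_def)
    then show ?thesis by auto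
  qed
  have bdd: "bdd_below P" by (rule bdd_belowI[of _ 0]) (auto simp: P_def)
  define g where "g = Inf P"
  have gle: "g \<le> x" if "x \<in> P" for x unfolding g_def by (rule cInf_lower[OF that bdd])
  obtain h where h: "h \<in> P" "h < g + \<epsilon>"
    using cInf_lessD[OF ne, of "g + \<epsilon>"] \<open>\<epsilon> > 0\<close> g_def by auto
  have "h = g"
  proof (rule ccontr)
    assume "h \<noteq> g"
    then have "g < h" using gle[OF h(1)] by simp
    then obtain h' where h': "h' \<in> P" "h' < h" using cInf_lessD[OF ne] g_def by metis
    then have "\<epsilon> \<le> h - h'" using h gap[OF diff] by (auto simp: P_def)
    then show False using gle[OF h'(1)] h(2) by simp
  qed
  then have gG: "g \<in> G" "g > 0" using h(1) by (auto simp: P_def)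
  have "y \<in> range (\<lambda>k::int. of_int k * g)" if "y \<in> G" for y
  proof -
    let ?k = "\<lfloor>y / g\<rfloor>"
    let ?r = "y - of_int ?k * g"
    have "?r \<in> G" using that int[OF gG(1)] diff by auto
    moreover have "0 \<le> ?r" "?r < g"
      using floor_divide_lower[OF gG(2), of y] floor_divide_upper[OF gG(2), of y]
      by (auto simp: algebra_simps)
    ultimately have "?r = 0" using gle[of ?r] by (force simp: P_def)
    then show ?thesis by auto
  qed
  then show ?thesis using int[OF gG(1)] by (intro exI[of _ g]) auto
qed

section \<open>The valuation, its residue field and its value group\<close>

locale real_valuation =
  fixes V :: "'k::field set" and v :: "'k \<Rightarrow> ereal"
  assumes assoc: "associated_valuation V v"
begin

lemma v_mult: "v (x * y) = v x + v y"
  and v_add: "min (v x) (v y) \<le> v (x + y)"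
  and V_iff: "x \<in> V \<longleftrightarrow> 0 \<le> v x"
  and v_eq_infinity: "v x = \<infinity> \<longleftrightarrow> x = 0"
  and v_not_minf: "v x \<noteq> -\<infinity>"
  using assoc by (auto simp: associated_valuation_def)

lemma v_minus: "v (- x) = v x"
  using associated_valuation_minus[OF assoc] .

lemma v_minus_commute: "v (x - y) = v (y - x)"
  using v_minus[of "x - y"] by simp

lemma v_0: "v 0 = \<infinity>" using v_eq_infinity by simp

lemma v_real: "x \<noteq> 0 \<Longrightarrow> \<exists>r. v x = ereal r"
  using v_eq_infinity[of x] v_not_minf[of x] by (cases "v x") auto

lemma V_iff_real: "v x = ereal r \<Longrightarrow> x \<in> V \<longleftrightarrow> 0 \<le> r"
  by (simp add: V_iff)

lemma v_1: "v 1 = 0"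
proof -
  obtain r where "v 1 = ereal r" using v_real[of 1] by auto
  then show ?thesis using v_mult[of 1 1] by simp
qed

lemma v_divide:
  assumes "v x = ereal r" "v y = ereal t"
  shows "v (x / y) = ereal (r - t)"
proof -
  have "y \<noteq> 0" using assms by (auto simp: v_0)
  then have "v x = v (x / y) + v y" using v_mult[of "x / y" y] by simp
  then show ?thesis using assms by (cases "v (x / y)") auto
qed

lemma v_diff_ge: "min (v x) (v y) \<le> v (x - y)"
  using v_add[of x "- y"] v_minus by simp

lemma v_add_eq:
  assumes "v x < v y"
  shows "v (x + y) = v x"
proof (rule antisym)
  show "v x \<le> v (x + y)" using v_add[of x y] assms by (simp add: min_def split: if_splits)
  show "v (x + y) \<le> v x"
    using v_diff_ge[of "x + y" y] assms by (auto simp: min_def split: if_splits)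
qed

lemma v_gt_add: "r < v x \<Longrightarrow> r < v y \<Longrightarrow> r < v (x + y)"
  using v_add[of x y] by (auto simp: min_def split: if_splits)

lemma v_gt_diff: "r < v x \<Longrightarrow> r < v y \<Longrightarrow> r < v (x - y)"
  using v_diff_ge[of x y] by (auto simp: min_def split: if_splits)

lemma v_ge_add: "r \<le> v x \<Longrightarrow> r \<le> v y \<Longrightarrow> r \<le> v (x + y)"
  using v_add[of x y] by (auto simp: min_def split: if_splits)

lemma v_ge_diff: "r \<le> v x \<Longrightarrow> r \<le> v y \<Longrightarrow> r \<le> v (x - y)"
  using v_diff_ge[of x y] by (auto simp: min_def split: if_splits)

lemma v_mult_nonneg: "0 \<le> v x \<Longrightarrow> 0 \<le> v y \<Longrightarrow> 0 \<le> v (x * y)"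
  by (simp add: v_mult)

lemma v_mult_pos: "0 < v x \<Longrightarrow> 0 \<le> v y \<Longrightarrow> 0 < v (x * y)"
  by (simp add: v_mult add_pos_nonneg)

lemma v_inverse: "v x = ereal r \<Longrightarrow> v (inverse x) = ereal (- r)"
  using v_divide[of 1 0 x r] v_1 by (simp add: inverse_eq_divide)

lemma V_or_inverse:
  assumes "x \<notin> V"
  shows "inverse x \<in> V"
proof -
  have "x \<noteq> 0" using assms by (auto simp: V_iff v_0)
  then obtain r where r: "v x = ereal r" using v_real by auto
  then show ?thesis using assms v_inverse[OF r] by (simp add: V_iff)
qed

lemma maximal_ideal_iff: "x \<in> maximal_ideal V \<longleftrightarrow> 0 < v x"
proof (cases "x = 0")
  case True
  then show ?thesis by (simp add: maximal_ideal_def V_iff v_0)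
next
  case False
  then obtain r where r: "v x = ereal r" using v_real by auto
  then show ?thesis using False v_inverse[OF r] by (auto simp: maximal_ideal_def V_iff)
qed

text \<open>\<open>T\<close> picks one element from each residue class, so that arguments over the
  residue field can be carried out in \<open>V\<close> itself. Distinct representatives differ by a
  unit, because their difference lies outside the maximal ideal.\<close>

lemma residue_representatives:
  obtains T where "T \<subseteq> V" "\<And>x. x \<in> V \<Longrightarrow> \<exists>t\<in>T. 0 < v (x - t)"
    "\<And>s t. s \<in> T \<Longrightarrow> t \<in> T \<Longrightarrow> s \<noteq> t \<Longrightarrow> v (s - t) = 0"
    "finite T \<longleftrightarrow> finite (residue_field V)"
proof -
  define R where "R = {(x, y). x \<in> V \<and> y \<in> V \<and> 0 < v (x - y)}"
  have RF: "residue_field V = V // R"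
    by (simp add: residue_field_def R_def maximal_ideal_iff)
  have "trans R"
  proof (rule transI)
    fix x y z assume "(x, y) \<in> R" "(y, z) \<in> R"
    then show "(x, z) \<in> R" using v_gt_add[of 0 "x - y" "y - z"] by (auto simp: R_def)
  qed
  then have eq: "equiv V R"
    by (intro equivI) (auto simp: R_def refl_on_def sym_def v_0 v_minus_commute)
  define f where "f = (\<lambda>C::'k set. SOME x. x \<in> C)"
  have f: "f C \<in> C" if "C \<in> V // R" for C
    unfolding f_def using in_quotient_imp_non_empty[OF eq that] by (simp add: some_in_eq)
  have inj: "inj_on f (V // R)"
  proof (rule inj_onI)
    fix C D assume "C \<in> V // R" "D \<in> V // R" "f C = f D"
    then show "C = D" using f[of C] f[of D] quotient_disj[OF eq] by (metis disjoint_iff)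
  qed
  define T where "T = f ` (V // R)"
  have TV: "T \<subseteq> V" using f in_quotient_imp_subset[OF eq] by (auto simp: T_def)
  show thesis
  proof (rule that[of T])
    show "T \<subseteq> V" by fact
    show "\<exists>t\<in>T. 0 < v (x - t)" if "x \<in> V" for x
    proof -
      have C: "R `` {x} \<in> V // R" using that by (rule quotientI)
      have "(x, f (R `` {x})) \<in> R" using f[OF C] by simp
      then show ?thesis using C by (auto simp: R_def T_def)
    qed
    show "v (s - t) = 0" if st: "s \<in> T" "t \<in> T" "s \<noteq> t" for s t
    proof (rule ccontr)
      assume "v (s - t) \<noteq> 0"
      moreover have "0 \<le> v (s - t)" using v_ge_diff st(1,2) TV V_iff by (meson subsetD)
      ultimately have r: "(s, t) \<in> R" using st TV by (auto simp: R_def)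
      obtain C D where CD: "C \<in> V // R" "s = f C" "D \<in> V // R" "t = f D"
        using st by (auto simp: T_def)
      then have "C = D" using quotient_eqI[OF eq CD(1,3) f[OF CD(1)] f[OF CD(3)]] r by simp
      then show False using st CD by simp
    qed
    show "finite T \<longleftrightarrow> finite (residue_field V)"
      unfolding T_def RF using inj by (rule finite_image_iff)
  qed
qed

lemma value_group_0: "0 \<in> value_group v"
  using v_1 by (auto simp: value_group_def intro!: exI[of _ 1])

lemma value_group_diff:
  assumes "r \<in> value_group v" "t \<in> value_group v"
  shows "r - t \<in> value_group v"
  using assms v_divide unfolding value_group_def by blast

lemma value_group_minus: "r \<in> value_group v \<Longrightarrow> - r \<in> value_group v"
  using value_group_diff[OF value_group_0] by simp

lemma value_group_add: "r \<in> value_group v \<Longrightarrow> t \<in> value_group v \<Longrightarrow> r + t \<in> value_group v"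
  using value_group_diff[of r "- t"] value_group_minus by simp

lemma value_group_nat: "r \<in> value_group v \<Longrightarrow> of_nat k * r \<in> value_group v"
  by (induction k) (auto simp: value_group_0 algebra_simps intro: value_group_add)

lemma value_group_int: "r \<in> value_group v \<Longrightarrow> of_int k * r \<in> value_group v"
  by (cases k rule: int_cases2) (use value_group_nat value_group_minus in auto)

text \<open>By \<open>real_subgroup_cyclic\<close>, a nondiscrete value group contains arbitrarily
  small positive elements, and the multiples of one smaller than \<epsilon> cannot jump over the
  interval.\<close>

lemma value_group_dense_right:
  assumes "\<not> discrete_value_group v" "\<epsilon> > 0"
  shows "\<exists>r\<in>value_group v. \<delta> < r \<and> r < \<delta> + \<epsilon>"
proof -
  obtain g where g: "g \<in> value_group v" "0 < g" "g < \<epsilon>"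
    using real_subgroup_cyclic[OF value_group_0 value_group_diff, of \<epsilon>] assms
    by (force simp: discrete_value_group_def)
  \<comment> \<open>The least multiple of \<open>g\<close> strictly above \<delta>.\<close>
  let ?r = "of_int (\<lfloor>\<delta> / g\<rfloor> + 1) * g"
  have "\<delta> / g < of_int (\<lfloor>\<delta> / g\<rfloor> + 1)" "of_int (\<lfloor>\<delta> / g\<rfloor> + 1) \<le> \<delta> / g + 1" by linarith+
  then have "\<delta> < ?r" "?r \<le> \<delta> + g" using g(2) by (auto simp: field_simps)
  then show ?thesis using g(3) value_group_int[OF g(1), of "\<lfloor>\<delta> / g\<rfloor> + 1"]
    by (intro bexI[of _ ?r]) auto
qed

lemma decreasing_values:
  assumes "\<not> discrete_value_group v"
  obtains \<gamma> where "\<And>n. \<gamma> n \<in> value_group v" "\<And>n. \<gamma> (Suc n) < \<gamma> n" "\<And>n. \<delta> < \<gamma> n"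
    "\<gamma> \<longlonglongrightarrow> \<delta>"
proof -
  have "\<exists>\<gamma>. \<forall>n. (\<gamma> n \<in> value_group v \<and> \<delta> < \<gamma> n \<and> \<gamma> n < \<delta> + 1 / real (Suc n)) \<and> \<gamma> (Suc n) < \<gamma> n"
  proof (rule dependent_nat_choice)
    show "\<exists>x. x \<in> value_group v \<and> \<delta> < x \<and> x < \<delta> + 1 / real (Suc 0)"
      using value_group_dense_right[OF assms, of 1 \<delta>] by auto
  next
    fix x n assume "x \<in> value_group v \<and> \<delta> < x \<and> x < \<delta> + 1 / real (Suc n)"
    \<comment> \<open>This width keeps the next value below \<open>x\<close> and within the
      shrinking distance that forces convergence.\<close>
    then have "0 < min (x - \<delta>) (1 / real (Suc (Suc n)))" by simp
    from value_group_dense_right[OF assms this, of \<delta>]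
    show "\<exists>y. (y \<in> value_group v \<and> \<delta> < y \<and> y < \<delta> + 1 / real (Suc (Suc n))) \<and> y < x"
      by (smt (verit) min_def)
  qed
  then obtain \<gamma> where \<gamma>: "\<And>n. \<gamma> n \<in> value_group v" "\<And>n. \<gamma> (Suc n) < \<gamma> n" "\<And>n. \<delta> < \<gamma> n"
    "\<And>n. \<gamma> n < \<delta> + 1 / real (Suc n)" by blast
  have "(\<lambda>n. \<delta> + 1 / real (Suc n)) \<longlonglongrightarrow> \<delta>"
    using tendsto_add[OF tendsto_const LIMSEQ_Suc[OF lim_1_over_n], of \<delta>] by simp
  then have "\<gamma> \<longlonglongrightarrow> \<delta>"
    by (intro tendsto_sandwich[of "\<lambda>_. \<delta>" \<gamma>])
       (use \<gamma>(3,4) in \<open>auto intro!: always_eventually less_imp_le\<close>)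
  then show thesis using that \<gamma> by blast
qed

section \<open>Eventual values of rational functions along a filter of radii\<close>

text \<open>Radii follow a filter rather than a limit, so that \<open>at_right \<delta>\<close> and
  \<open>nhds \<delta>\<close> are handled together. They are real only eventually, since the centre
  \<open>s 0\<close> of a sequence \<open>s\<close> is itself a term.\<close>

definition approaches :: "(nat \<Rightarrow> 'k) \<Rightarrow> 'k \<Rightarrow> real filter \<Rightarrow> bool" where
  "approaches x a F \<longleftrightarrow>
     (\<exists>\<gamma>. (\<forall>\<^sub>F n in sequentially. v (x n - a) = ereal (\<gamma> n)) \<and> filterlim \<gamma> F sequentially)"

lemma approaches_mono: "approaches x a F \<Longrightarrow> F \<le> G \<Longrightarrow> approaches x a G"
  unfolding approaches_def by (meson filterlim_mono order_refl)

lemma eventually_approaches: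
  assumes "approaches x a F" "\<forall>\<^sub>F \<gamma> in F. \<forall>z. v (z - a) = ereal \<gamma> \<longrightarrow> P z"
  shows "\<forall>\<^sub>F n in sequentially. P (x n)"
proof -
  obtain \<gamma> where \<gamma>: "\<forall>\<^sub>F n in sequentially. v (x n - a) = ereal (\<gamma> n)" "filterlim \<gamma> F sequentially"
    using assms(1) by (auto simp: approaches_def)
  have "\<forall>\<^sub>F n in sequentially. \<forall>z. v (z - a) = ereal (\<gamma> n) \<longrightarrow> P z"
    using eventually_compose_filterlim[OF assms(2) \<gamma>(2)] .
  with \<gamma>(1) show ?thesis by eventually_elim simp
qed

text \<open>The affine function \<open>r + k \<gamma>\<close> is the difference of the valuations of two monomials at points
  of valuation \<open>\<gamma>\<close>, so along a decisive filter one of the two eventually dominates.\<close>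

definition decisive :: "real filter \<Rightarrow> bool" where
  "decisive F \<longleftrightarrow> (\<forall>r\<in>value_group v. \<forall>k::int. k \<noteq> 0 \<longrightarrow>
     (\<forall>\<^sub>F \<gamma> in F. r + of_int k * \<gamma> < 0) \<or> (\<forall>\<^sub>F \<gamma> in F. 0 < r + of_int k * \<gamma>))"

text \<open>If the affine function is nonzero at \<delta>, continuity preserves its sign; if it
  vanishes there, the sign to the right is that of the slope \<open>k\<close>.\<close>

lemma decisive_at_right: "decisive (at_right \<delta>)"
  unfolding decisive_def
proof (intro ballI allI impI)
  fix r and k :: int assume "k \<noteq> 0"
  have lim: "((\<lambda>\<gamma>. r + of_int k * \<gamma>) \<longlongrightarrow> r + of_int k * \<delta>) (at_right \<delta>)"
    by (intro tendsto_intros)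
  have right: "\<forall>\<^sub>F \<gamma> in at_right \<delta>. \<delta> < \<gamma>" by (simp add: eventually_at_right_less)
  consider "r + of_int k * \<delta> < 0" | "0 < r + of_int k * \<delta>"
    | "r = - of_int k * \<delta>" "0 < k" | "r = - of_int k * \<delta>" "k < 0"
    using \<open>k \<noteq> 0\<close> by fastforce
  then show "(\<forall>\<^sub>F \<gamma> in at_right \<delta>. r + of_int k * \<gamma> < 0) \<or> (\<forall>\<^sub>F \<gamma> in at_right \<delta>. 0 < r + of_int k * \<gamma>)"
  proof cases
    case 1
    then show ?thesis using order_tendstoD(2)[OF lim] by blast
  next
    case 2
    then show ?thesis using order_tendstoD(1)[OF lim] by blast
  next
    case 3
    have "\<forall>\<^sub>F \<gamma> in at_right \<delta>. 0 < r + of_int k * \<gamma>"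
      using right by eventually_elim (use 3 in simp)
    then show ?thesis ..
  next
    case 4
    have "\<forall>\<^sub>F \<gamma> in at_right \<delta>. r + of_int k * \<gamma> < 0"
      using right by eventually_elim (use 4 in simp)
    then show ?thesis ..
  qed
qed

text \<open>A zero of the affine function at \<delta> would put a nonzero multiple of \<delta> into
  the value group. Hence the function is nonzero at \<delta> and keeps its sign on both
  sides.\<close>

lemma decisive_nhds:
  assumes "\<delta> \<notin> divisible_hull v"
  shows "decisive (nhds \<delta>)"
  unfolding decisive_def
proof (intro ballI allI impI)
  fix r and k :: int assume r: "r \<in> value_group v" and "k \<noteq> 0"
  have lim: "((\<lambda>\<gamma>. r + of_int k * \<gamma>) \<longlongrightarrow> r + of_int k * \<delta>) (nhds \<delta>)"
    by (intro tendsto_intros filterlim_ident)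
  have "r + of_int k * \<delta> \<noteq> 0"
  proof
    assume z: "r + of_int k * \<delta> = 0"
    have "of_nat (nat \<bar>k\<bar>) * \<delta> = r \<or> of_nat (nat \<bar>k\<bar>) * \<delta> = - r"
      using z by (cases "0 \<le> k") (auto simp: algebra_simps)
    then have "of_nat (nat \<bar>k\<bar>) * \<delta> \<in> value_group v" using r value_group_minus[OF r] by auto
    then show False using assms \<open>k \<noteq> 0\<close> unfolding divisible_hull_def
      by (metis (mono_tags, lifting) mem_Collect_eq zero_less_abs_iff zero_less_nat_eq)
  qed
  then show "(\<forall>\<^sub>F \<gamma> in nhds \<delta>. r + of_int k * \<gamma> < 0) \<or> (\<forall>\<^sub>F \<gamma> in nhds \<delta>. 0 < r + of_int k * \<gamma>)"
    using order_tendstoD[OF lim] by (meson linorder_neqE_linordered_idom)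
qed

text \<open>A constant affine function may be zero and then has no strict sign, so
  \<open>decisive\<close> leaves out slope \<open>0\<close>. The weak inequality, which is what
  membership in \<open>V\<close> asks for, covers it.\<close>

lemma decisive_sign:
  assumes "decisive F" "r \<in> value_group v"
  shows "(\<forall>\<^sub>F \<gamma> in F. r + of_int k * \<gamma> < 0) \<or> (\<forall>\<^sub>F \<gamma> in F. 0 \<le> r + of_int k * \<gamma>)"
proof (cases "k = 0")
  case True
  then show ?thesis by (cases "r < 0") auto
next
  case False
  then show ?thesis
    using assms unfolding decisive_def by (metis (mono_tags, lifting) eventually_mono less_imp_le)
qed

text \<open>Horner induction: \<open>c\<close> and \<open>x * poly p x\<close> have values
  \<open>t\<close> and \<open>r + (k + 1) * \<gamma>\<close>. Along a decisive filter one of these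
  is eventually the smaller, and the term of smaller value determines that of the sum.\<close>

lemma eventually_v_poly_at_0:
  assumes "decisive F" "p \<noteq> 0"
  shows "\<exists>r\<in>value_group v. \<exists>k::nat. \<forall>\<^sub>F \<gamma> in F. \<forall>x. v x = ereal \<gamma> \<longrightarrow>
    v (poly p x) = ereal (r + of_nat k * \<gamma>)"
  using assms(2)
proof (induction p)
  case 0
  then show ?case by simp
next
  case (pCons c p)
  show ?case
  proof (cases "p = 0")
    case True
    then obtain r where "v c = ereal r" using pCons.prems v_real by auto
    then show ?thesis using True by (intro bexI[of _ r] exI[of _ 0]) (auto simp: value_group_def)
  next
    case False
    then obtain r k where r: "r \<in> value_group v"
      and p: "\<forall>\<^sub>F \<gamma> in F. \<forall>x. v x = ereal \<gamma> \<longrightarrow> v (poly p x) = ereal (r + of_nat k * \<gamma>)"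
      using pCons.IH by auto
    from p have ev: "\<forall>\<^sub>F \<gamma> in F. \<forall>x. v x = ereal \<gamma> \<longrightarrow>
        v (x * poly p x) = ereal (r + of_nat (Suc k) * \<gamma>)"
      by eventually_elim (auto simp: v_mult algebra_simps)
    show ?thesis
    proof (cases "c = 0")
      case True
      then show ?thesis using ev r by (intro bexI[of _ r] exI[of _ "Suc k"]) auto
    next
      case False
      then obtain t where t: "v c = ereal t" using v_real by auto
      then have tG: "t \<in> value_group v" by (auto simp: value_group_def)
      consider "\<forall>\<^sub>F \<gamma> in F. (r - t) + of_int (int (Suc k)) * \<gamma> < 0"
        | "\<forall>\<^sub>F \<gamma> in F. 0 < (r - t) + of_int (int (Suc k)) * \<gamma>"
        using bspec[OF assms(1)[unfolded decisive_def] value_group_diff[OF r tG],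
            rule_format, of "int (Suc k)"] by fastforce
      then show ?thesis
      proof cases
        case 1
        have "\<forall>\<^sub>F \<gamma> in F. \<forall>x. v x = ereal \<gamma> \<longrightarrow>
            v (poly (pCons c p) x) = ereal (r + of_nat (Suc k) * \<gamma>)"
          using ev 1
        proof eventually_elim
          case (elim \<gamma>)
          then show ?case using v_add_eq[of "_ * poly p _" c] t by (auto simp: add.commute)
        qed
        then show ?thesis using r by blast
      next
        case 2
        have "\<forall>\<^sub>F \<gamma> in F. \<forall>x. v x = ereal \<gamma> \<longrightarrow>
            v (poly (pCons c p) x) = ereal (t + of_nat 0 * \<gamma>)"
          using ev 2
        proof eventually_elim
          case (elim \<gamma>)
          then show ?case using v_add_eq[of c "_ * poly p _"] t by auto
        qed
        then show ?thesis using tG by blast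
      qed
    qed
  qed
qed

lemma eventually_v_poly:
  assumes "decisive F" "p \<noteq> 0"
  shows "\<exists>r\<in>value_group v. \<exists>k::nat. \<forall>\<^sub>F \<gamma> in F. \<forall>x. v (x - a) = ereal \<gamma> \<longrightarrow>
    v (poly p x) = ereal (r + of_nat k * \<gamma>)"
proof -
  \<comment> \<open>The substitution of \<open>X + a\<close> moves the centre to
    \<open>0\<close>.\<close>
  let ?q = "pcompose p [:a, 1:]"
  have "?q \<noteq> 0" using assms(2) by (simp add: pcompose_eq_0_iff)
  from eventually_v_poly_at_0[OF assms(1) this] obtain r and k :: nat where "r \<in> value_group v"
    and ev: "\<forall>\<^sub>F \<gamma> in F. \<forall>x. v x = ereal \<gamma> \<longrightarrow> v (poly ?q x) = ereal (r + of_nat k * \<gamma>)" by auto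
  moreover have "\<forall>\<^sub>F \<gamma> in F. \<forall>x. v (x - a) = ereal \<gamma> \<longrightarrow>
      v (poly p x) = ereal (r + of_nat k * \<gamma>)"
    using ev
  proof eventually_elim
    case (elim \<gamma>)
    have "poly ?q (x - a) = poly p x" for x by (simp add: poly_pcompose)
    then show ?case using elim by metis
  qed
  ultimately show ?thesis by blast
qed

text \<open>For nonzero \<phi>, the valuation of \<phi> at a point of radius \<gamma> is affine in
  \<gamma>, so its sign settles eventually. The second alternative provides an actual value outside
  \<open>V\<close>, whose inverse then lies in \<open>V\<close>; mere failure of membership would
  not exclude poles.\<close>

lemma value_dichotomy:
  assumes "decisive F"
  shows "(\<forall>\<^sub>F \<gamma> in F. \<forall>x. v (x - a) = ereal \<gamma> \<longrightarrow> (\<exists>y\<in>V. has_value_at \<phi> x y)) \<or>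
    (\<forall>\<^sub>F \<gamma> in F. \<forall>x. v (x - a) = ereal \<gamma> \<longrightarrow> (\<exists>y. y \<notin> V \<and> has_value_at \<phi> x y))"
proof -
  obtain p q where \<phi>: "\<phi> = Fract p q" "q \<noteq> 0" by (cases \<phi>)
  show ?thesis
  proof (cases "p = 0")
    case True
    have "\<exists>y\<in>V. has_value_at \<phi> x y" for x
      using has_value_at_const[of 0 x] \<phi> True
      by (intro bexI[of _ 0]) (simp_all add: fract_collapse to_fract_def V_iff v_0)
    then show ?thesis by simp
  next
    case False
    obtain r and k :: nat where r: "r \<in> value_group v" and
      p: "\<forall>\<^sub>F \<gamma> in F. \<forall>x. v (x - a) = ereal \<gamma> \<longrightarrow> v (poly p x) = ereal (r + of_nat k * \<gamma>)"
      using eventually_v_poly[OF assms False] by blast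
    obtain t and l :: nat where t: "t \<in> value_group v" and
      q: "\<forall>\<^sub>F \<gamma> in F. \<forall>x. v (x - a) = ereal \<gamma> \<longrightarrow> v (poly q x) = ereal (t + of_nat l * \<gamma>)"
      using eventually_v_poly[OF assms \<phi>(2)] by blast
    define w where "w = (\<lambda>\<gamma>::real. (r - t) + of_int (int k - int l) * \<gamma>)"
    have ev: "\<forall>\<^sub>F \<gamma> in F. \<forall>x. v (x - a) = ereal \<gamma> \<longrightarrow>
        (\<exists>y. has_value_at \<phi> x y \<and> v y = ereal (w \<gamma>))"
      using p q
    proof eventually_elim
      case (elim \<gamma>)
      show ?case
      proof (intro allI impI)
        fix x assume "v (x - a) = ereal \<gamma>"
        then have px: "v (poly p x) = ereal (r + of_nat k * \<gamma>)"
          and qx: "v (poly q x) = ereal (t + of_nat l * \<gamma>)" using elim by auto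
        then have "poly q x \<noteq> 0" by (auto simp: v_0)
        then show "\<exists>y. has_value_at \<phi> x y \<and> v y = ereal (w \<gamma>)"
          using has_value_at_Fract v_divide[OF px qx] \<phi>(1) by (auto simp: w_def algebra_simps)
      qed
    qed
    consider "\<forall>\<^sub>F \<gamma> in F. w \<gamma> < 0" | "\<forall>\<^sub>F \<gamma> in F. 0 \<le> w \<gamma>"
      unfolding w_def using decisive_sign[OF assms value_group_diff[OF r t]] by blast
    then show ?thesis
    proof cases
      case 1
      with ev have "\<forall>\<^sub>F \<gamma> in F. \<forall>x. v (x - a) = ereal \<gamma> \<longrightarrow> (\<exists>y. y \<notin> V \<and> has_value_at \<phi> x y)"
        by eventually_elim (metis V_iff_real not_le)
      then show ?thesis ..
    next
      case 2
      with ev have "\<forall>\<^sub>F \<gamma> in F. \<forall>x. v (x - a) = ereal \<gamma> \<longrightarrow> (\<exists>y\<in>V. has_value_at \<phi> x y)"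
        by eventually_elim (metis V_iff_real not_le)
      then show ?thesis ..
    qed
  qed
qed

section \<open>Rings determined by a centre and a filter\<close>

text \<open>The alternatives in \<open>value_dichotomy\<close> depend on \<open>a\<close> and
  \<open>F\<close> only, so membership of \<phi> is decided the same way for both sequences.\<close>

lemma seq_domain_cong:
  assumes "decisive F" "approaches x a F" "approaches y a F"
  shows "seq_domain V x = seq_domain V y"
proof -
  have "seq_domain V x \<subseteq> seq_domain V y" if xy: "approaches x a F" "approaches y a F" for x y
  proof
    fix \<phi> assume "\<phi> \<in> seq_domain V x"
    then have ev: "\<forall>\<^sub>F n in sequentially. \<exists>y\<in>V. has_value_at \<phi> (x n) y"
      by (simp add: seq_domain_def)
    show "\<phi> \<in> seq_domain V y"
      using value_dichotomy[OF assms(1), of a \<phi>]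
    proof
      assume "\<forall>\<^sub>F \<gamma> in F. \<forall>x. v (x - a) = ereal \<gamma> \<longrightarrow> (\<exists>y\<in>V. has_value_at \<phi> x y)"
      from eventually_approaches[OF xy(2) this] show ?thesis by (simp add: seq_domain_def)
    next
      assume "\<forall>\<^sub>F \<gamma> in F. \<forall>x. v (x - a) = ereal \<gamma> \<longrightarrow> (\<exists>y. y \<notin> V \<and> has_value_at \<phi> x y)"
      from eventually_approaches[OF xy(1) this] ev
      have "\<forall>\<^sub>F n in sequentially. False"
        by eventually_elim (use has_value_at_unique in blast)
      then show ?thesis by simp
    qed
  qed
  then show ?thesis using assms by blast
qed

text \<open>Closure under difference and product holds pointwise; the valuation property comes from
  the dichotomy, since a value outside \<open>V\<close> has its inverse in \<open>V\<close>.\<close>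

lemma seq_domain_in_Zar:
  assumes "decisive F" "approaches x a F"
  shows "seq_domain V x \<in> Zar V"
proof -
  have const: "to_fract [:c:] \<in> seq_domain V x" if "c \<in> V" for c
    unfolding seq_domain_def using has_value_at_const that by (auto intro!: always_eventually)
  have diff: "\<phi> - \<psi> \<in> seq_domain V x" and mult: "\<phi> * \<psi> \<in> seq_domain V x"
    if "\<phi> \<in> seq_domain V x" "\<psi> \<in> seq_domain V x" for \<phi> \<psi>
  proof -
    have ev: "\<forall>\<^sub>F n in sequentially. \<exists>y\<in>V. has_value_at \<phi> (x n) y"
      "\<forall>\<^sub>F n in sequentially. \<exists>y\<in>V. has_value_at \<psi> (x n) y"
      using that by (auto simp: seq_domain_def)
    then have "\<forall>\<^sub>F n in sequentially. \<exists>y\<in>V. has_value_at (\<phi> - \<psi>) (x n) y"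
      by eventually_elim (meson has_value_at_diff v_ge_diff V_iff)
    then show "\<phi> - \<psi> \<in> seq_domain V x" by (simp add: seq_domain_def)
    from ev have "\<forall>\<^sub>F n in sequentially. \<exists>y\<in>V. has_value_at (\<phi> * \<psi>) (x n) y"
      by eventually_elim (meson has_value_at_mult v_mult_nonneg V_iff)
    then show "\<phi> * \<psi> \<in> seq_domain V x" by (simp add: seq_domain_def)
  qed
  have inv: "\<phi> \<in> seq_domain V x \<or> inverse \<phi> \<in> seq_domain V x" for \<phi>
    using value_dichotomy[OF assms(1), of a \<phi>]
  proof
    assume "\<forall>\<^sub>F \<gamma> in F. \<forall>x. v (x - a) = ereal \<gamma> \<longrightarrow> (\<exists>y\<in>V. has_value_at \<phi> x y)"
    from eventually_approaches[OF assms(2) this] show ?thesis by (simp add: seq_domain_def)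
  next
    assume "\<forall>\<^sub>F \<gamma> in F. \<forall>x. v (x - a) = ereal \<gamma> \<longrightarrow> (\<exists>y. y \<notin> V \<and> has_value_at \<phi> x y)"
    from eventually_approaches[OF assms(2) this]
    have "\<forall>\<^sub>F n in sequentially. \<exists>y\<in>V. has_value_at (inverse \<phi>) (x n) y"
    proof eventually_elim
      case (elim n)
      then obtain y where y: "y \<notin> V" "has_value_at \<phi> (x n) y" by auto
      then have "y \<noteq> 0" by (auto simp: V_iff v_0)
      then show ?case using y has_value_at_inverse V_or_inverse by blast
    qed
    then show ?thesis by (simp add: seq_domain_def)
  qed
  have "0 \<in> V" "1 \<in> V" by (simp_all add: V_iff v_0 v_1)
  then have "0 \<in> seq_domain V x" "1 \<in> seq_domain V x"
    using const[of 0] const[of 1] by (simp_all flip: one_pCons)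
  then show ?thesis unfolding Zar_def valuation_domain_def using const diff mult inv by auto
qed

text \<open>The radii tend to \<delta> and eventually fall below \<open>v (a - b)\<close>, from
  which point on \<open>x n\<close> has the same distance from \<open>a\<close> and from
  \<open>b\<close>.\<close>

lemma approaches_recenter:
  assumes "approaches x a (at_right \<delta>)" "ereal \<delta> < v (a - b)"
  shows "approaches x b (at_right \<delta>)"
proof -
  obtain \<gamma> where \<gamma>: "\<forall>\<^sub>F n in sequentially. v (x n - a) = ereal (\<gamma> n)"
    "filterlim \<gamma> (at_right \<delta>) sequentially"
    using assms(1) by (auto simp: approaches_def)
  have "\<gamma> \<longlonglongrightarrow> \<delta>" using \<gamma>(2) by (simp add: filterlim_at)
  then have "(\<lambda>n. ereal (\<gamma> n)) \<longlonglongrightarrow> ereal \<delta>" by simp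
  then have "\<forall>\<^sub>F n in sequentially. ereal (\<gamma> n) < v (a - b)"
    using assms(2) by (rule order_tendstoD(2))
  with \<gamma>(1) have "\<forall>\<^sub>F n in sequentially. v (x n - b) = ereal (\<gamma> n)"
  proof eventually_elim
    case (elim n)
    then show ?case using v_add_eq[of "x n - a" "a - b"] by simp
  qed
  then show ?thesis using \<gamma>(2) by (auto simp: approaches_def)
qed

lemma approaches_at_right_gt:
  assumes "approaches x a (at_right \<delta>)"
  shows "\<forall>\<^sub>F n in sequentially. ereal \<delta> < v (x n - a)"
  using assms
  by (rule eventually_approaches) (auto intro: eventually_mono[OF eventually_at_right_less])

section \<open>Centres and radii of pseudo-divergent and pseudo-convergent sequences\<close>

text \<open>Among the consecutive differences leading from \<open>s 0\<close> to
  \<open>s (Suc n)\<close> the last has the strictly smallest value, so it alone determines the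
  distance from \<open>s 0\<close>.\<close>

lemma pseudo_divergent_approaches:
  assumes "pseudo_divergent v s" "breadth v s = ereal \<delta>"
  shows "approaches s (s 0) (at_right \<delta>)"
proof -
  define d where "d = (\<lambda>n. v (s (n+1) - s n))"
  have dec: "d (Suc n) < d n" for n
    using assms(1) unfolding pseudo_divergent_def d_def
    by (simp add: v_minus_commute numeral_2_eq_2)
  have "decseq d" using dec by (intro decseq_SucI) (simp add: less_imp_le)
  then have "d \<longlonglongrightarrow> (INF n. d n)" by (rule LIMSEQ_INF)
  moreover have "lim d = ereal \<delta>" using assms(2) by (simp add: breadth_def d_def)
  ultimately have lim: "d \<longlonglongrightarrow> ereal \<delta>" and inf: "(INF n. d n) = ereal \<delta>" using limI by metis+
  have "ereal \<delta> \<le> d n" for n using inf by (metis INF_lower UNIV_I)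
  then have gt: "ereal \<delta> < d n" for n using dec[of n] by (metis order_le_less_trans)
  \<comment> \<open>\<open>d 0\<close> is infinite if \<open>s 1 = s 0\<close>; from index
    \<open>1\<close> on the strict decrease makes the values finite.\<close>
  have fin: "\<bar>d (Suc n)\<bar> \<noteq> \<infinity>" for n using dec[of n] gt[of "Suc n"] by auto
  have vd: "v (s (Suc n) - s 0) = d n" for n
  proof (induction n)
    case 0
    then show ?case by (simp add: d_def)
  next
    case (Suc n)
    have "d (Suc n) < v (s (Suc n) - s 0)" using dec[of n] Suc by simp
    then show ?case
      using v_add_eq[of "s (Suc (Suc n)) - s (Suc n)" "s (Suc n) - s 0"] by (simp add: d_def)
  qed
  \<comment> \<open>The shift by one matches \<open>v (s (Suc n) - s 0) = d n\<close>; the radius is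
    therefore certain to be real from \<open>n = 2\<close> on.\<close>
  define \<gamma> where "\<gamma> = (\<lambda>n. real_of_ereal (d (n - 1)))"
  have eq: "v (s n - s 0) = ereal (\<gamma> n) \<and> \<delta> < \<gamma> n" if n: "n \<ge> 2" for n
  proof -
    obtain m where m: "n = Suc (Suc m)" using n by (metis add_2_eq_Suc le_Suc_ex)
    have g: "ereal (\<gamma> n) = d (Suc m)" using fin[of m] by (simp add: \<gamma>_def m ereal_real')
    show ?thesis using vd[of "Suc m"] gt[of "Suc m"] m by (simp flip: g)
  qed
  have "(\<lambda>n. real_of_ereal (d n)) \<longlonglongrightarrow> \<delta>"
    using lim by (rule lim_real_of_ereal)
  then have "(\<lambda>n. \<gamma> (Suc n)) \<longlonglongrightarrow> \<delta>" by (simp add: \<gamma>_def)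
  then have "\<gamma> \<longlonglongrightarrow> \<delta>" by (rule LIMSEQ_imp_Suc)
  moreover have ev: "\<forall>\<^sub>F n in sequentially. v (s n - s 0) = ereal (\<gamma> n) \<and> \<delta> < \<gamma> n"
    using eventually_ge_at_top[of 2] by eventually_elim (rule eq)
  ultimately have "filterlim \<gamma> (at_right \<delta>) sequentially"
    unfolding filterlim_at by (auto elim: eventually_mono)
  then show ?thesis
    using ev unfolding approaches_def by (intro exI[of _ \<gamma>]) (auto elim: eventually_mono)
qed

lemma pseudo_convergent_values:
  assumes "pseudo_convergent v s" "breadth v s = ereal \<delta>"
  obtains \<gamma> where "\<And>n. v (s (Suc n) - s n) = ereal (\<gamma> n)" "\<And>n. \<gamma> n < \<gamma> (Suc n)" "\<gamma> \<longlonglongrightarrow> \<delta>"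
proof -
  define d where "d = (\<lambda>n. v (s (n+1) - s n))"
  have inc: "d n < d (Suc n)" for n
    using assms(1) unfolding pseudo_convergent_def d_def by (simp add: numeral_2_eq_2)
  have "incseq d" using inc by (intro incseq_SucI) (simp add: less_imp_le)
  then have "d \<longlonglongrightarrow> (SUP n. d n)" by (rule LIMSEQ_SUP)
  moreover have "lim d = ereal \<delta>" using assms(2) by (simp add: breadth_def d_def)
  ultimately have lim: "d \<longlonglongrightarrow> ereal \<delta>" using limI by metis
  have "d n \<noteq> -\<infinity>" for n using v_not_minf by (simp add: d_def)
  moreover have "d n \<noteq> \<infinity>" for n using inc[of n] by auto
  ultimately have d: "d n = ereal (real_of_ereal (d n))" for n
    by (metis ereal_real' abs_ereal.elims ereal_infinity_cases)
  show thesis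
  proof (rule that[of "\<lambda>n. real_of_ereal (d n)"])
    show "v (s (Suc n) - s n) = ereal (real_of_ereal (d n))" for n using d[of n] by (simp add: d_def)
    show "real_of_ereal (d n) < real_of_ereal (d (Suc n))" for n
      using inc[of n] d by (metis ereal_less_eq(3) linorder_not_le)
    show "(\<lambda>n. real_of_ereal (d n)) \<longlonglongrightarrow> \<delta>" using lim by (rule lim_real_of_ereal)
  qed
qed

text \<open>\<open>s n - \<alpha>\<close> has smaller value than
  \<open>\<alpha> - s (Suc n)\<close>, so the distance of \<open>s n\<close> from \<alpha> equals
  the increment \<open>v (s (Suc n) - s n)\<close>.\<close>

lemma pseudo_limit_approaches:
  assumes "pseudo_convergent v s" "breadth v s = ereal \<delta>" "pseudo_limit v s \<alpha>"
  shows "approaches s \<alpha> (nhds \<delta>)"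
proof -
  obtain \<gamma> where \<gamma>: "\<And>n. v (s (Suc n) - s n) = ereal (\<gamma> n)" "\<gamma> \<longlonglongrightarrow> \<delta>"
    using pseudo_convergent_values[OF assms(1,2)] by metis
  have "v (s n - \<alpha>) = ereal (\<gamma> n)" for n
  proof -
    have "v (s n - \<alpha>) < v (\<alpha> - s (Suc n))"
      using assms(3) v_minus_commute[of \<alpha>] by (simp add: pseudo_limit_def)
    then have "v (s n - s (Suc n)) = v (s n - \<alpha>)"
      using v_add_eq[of "s n - \<alpha>" "\<alpha> - s (Suc n)"] by simp
    then show ?thesis using \<gamma>(1)[of n] v_minus_commute by metis
  qed
  then show ?thesis using \<gamma>(2) by (auto simp: approaches_def intro!: exI[of _ \<gamma>])
qed

text \<open>Strictly increasing values in a discrete group grow by a fixed positive amount at least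
  and cannot converge. With \<open>V_div_breadth_discrete\<close> this makes both families empty for
  a discrete value group.\<close>

lemma discrete_no_convergent_values:
  assumes "discrete_value_group v" "pseudo_convergent v s"
  shows "breadth v s \<noteq> ereal \<delta>"
proof
  assume "breadth v s = ereal \<delta>"
  from pseudo_convergent_values[OF assms(2) this]
  obtain \<gamma> where \<gamma>: "\<And>n. v (s (Suc n) - s n) = ereal (\<gamma> n)" "\<And>n. \<gamma> n < \<gamma> (Suc n)" "\<gamma> \<longlonglongrightarrow> \<delta>"
    by metis
  obtain g where g: "value_group v = range (\<lambda>k::int. of_int k * g)"
    using assms(1) by (auto simp: discrete_value_group_def)
  have gap: "\<bar>g\<bar> \<le> \<gamma> (Suc n) - \<gamma> n" "g \<noteq> 0" for n
  proof -
    have "\<gamma> (Suc n) - \<gamma> n \<in> value_group v"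
      using \<gamma>(1) by (intro value_group_diff) (auto simp: value_group_def)
    then obtain k :: int where k: "\<gamma> (Suc n) - \<gamma> n = of_int k * g" using g by auto
    then have k0: "k \<noteq> 0" "g \<noteq> 0" using \<gamma>(2)[of n] by auto
    then have "1 \<le> \<bar>of_int k :: real\<bar>" by linarith
    then have "\<bar>g\<bar> \<le> \<bar>of_int k\<bar> * \<bar>g\<bar>" using mult_right_mono[of 1 "\<bar>of_int k :: real\<bar>" "\<bar>g\<bar>"] by simp
    then show "\<bar>g\<bar> \<le> \<gamma> (Suc n) - \<gamma> n" "g \<noteq> 0" using k k0 \<gamma>(2)[of n] by (simp_all add: abs_mult[symmetric])
  qed
  have "(\<lambda>n. \<gamma> (Suc n) - \<gamma> n) \<longlonglongrightarrow> \<delta> - \<delta>" using \<gamma>(3) by (intro tendsto_diff LIMSEQ_Suc)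
  then have "\<bar>g\<bar> \<le> \<delta> - \<delta>" using gap(1) by (intro LIMSEQ_le_const) auto
  then show False using gap(2) by simp
qed

text \<open>A single sequence \<open>e\<close> with \<open>v (e n)\<close> decreasing to \<delta>
  serves every centre, since translation leaves all differences unchanged.\<close>

lemma decreasing_offsets:
  assumes "\<not> discrete_value_group v"
  obtains e where "\<And>a. pseudo_divergent v (\<lambda>n. a + e n)" "\<And>a. breadth v (\<lambda>n. a + e n) = ereal \<delta>"
    "\<And>a. approaches (\<lambda>n. a + e n) a (at_right \<delta>)"
proof -
  obtain \<gamma> where \<gamma>: "\<And>n. \<gamma> n \<in> value_group v" "\<And>n. \<gamma> (Suc n) < \<gamma> n" "\<And>n. \<delta> < \<gamma> n" "\<gamma> \<longlonglongrightarrow> \<delta>"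
    using decreasing_values[OF assms] by metis
  have "\<forall>n. \<exists>x. v x = ereal (\<gamma> n)" using \<gamma>(1) by (simp add: value_group_def)
  then obtain e where e: "\<And>n. v (e n) = ereal (\<gamma> n)" by metis
  have d: "v (e n - e (Suc n)) = ereal (\<gamma> (Suc n))" for n
    using v_add_eq[of "- e (Suc n)" "e n"] e \<gamma>(2) by (simp add: v_minus)
  show thesis
  proof (rule that[of e])
    fix a
    show "pseudo_divergent v (\<lambda>n. a + e n)"
      using d \<gamma>(2) by (simp add: pseudo_divergent_def numeral_2_eq_2)
    have "(\<lambda>n. \<gamma> (Suc n)) \<longlonglongrightarrow> \<delta>" using \<gamma>(4) by (rule LIMSEQ_Suc)
    then show "breadth v (\<lambda>n. a + e n) = ereal \<delta>"
      unfolding breadth_def using d v_minus_commute by (intro limI) simp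
    show "approaches (\<lambda>n. a + e n) a (at_right \<delta>)"
      unfolding approaches_def using e \<gamma>(3,4)
      by (intro exI[of _ \<gamma>]) (auto simp: filterlim_at intro!: always_eventually dest: less_imp_neq)
  qed
qed

lemma increasing_offsets:
  assumes "\<not> discrete_value_group v"
  obtains e where "\<And>a. pseudo_convergent v (\<lambda>n. a + e n)" "\<And>a. breadth v (\<lambda>n. a + e n) = ereal \<delta>"
    "\<And>a. pseudo_limit v (\<lambda>n. a + e n) a"
proof -
  \<comment> \<open>Negating values that decrease to \<open>- \<delta>\<close> yields values that
    increase to \<delta>.\<close>
  obtain \<gamma> where \<gamma>: "\<And>n. \<gamma> n \<in> value_group v" "\<And>n. \<gamma> (Suc n) < \<gamma> n" "\<gamma> \<longlonglongrightarrow> - \<delta>"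
    using decreasing_values[OF assms] by metis
  have "\<forall>n. \<exists>x. v x = ereal (- \<gamma> n)"
    using value_group_minus[OF \<gamma>(1)] by (simp add: value_group_def)
  then obtain e where e: "\<And>n. v (e n) = ereal (- \<gamma> n)" by metis
  have d: "v (e (Suc n) - e n) = ereal (- \<gamma> n)" for n
    using v_add_eq[of "- e n" "e (Suc n)"] e \<gamma>(2) by (simp add: v_minus)
  show thesis
  proof (rule that[of e])
    fix a
    show "pseudo_convergent v (\<lambda>n. a + e n)"
      using d \<gamma>(2) by (simp add: pseudo_convergent_def numeral_2_eq_2)
    have "(\<lambda>n. - \<gamma> n) \<longlonglongrightarrow> \<delta>" using tendsto_minus[OF \<gamma>(3)] by simp
    then show "breadth v (\<lambda>n. a + e n) = ereal \<delta>"
      unfolding breadth_def using d by (intro limI) simp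
    show "pseudo_limit v (\<lambda>n. a + e n) a"
      using e \<gamma>(2) by (simp add: pseudo_limit_def v_minus)
  qed
qed

section \<open>Comparison of the pseudo-divergent and pseudo-convergent families\<close>

lemma V_div_breadthI:
  "pseudo_divergent v s \<Longrightarrow> breadth v s = ereal \<delta> \<Longrightarrow> seq_domain V s \<in> V_div_breadth V v \<delta>"
  unfolding V_div_breadth_def by blast

lemma V_K_breadthI:
  "pseudo_convergent v s \<Longrightarrow> breadth v s = ereal \<delta> \<Longrightarrow> pseudo_limit v s \<alpha> \<Longrightarrow>
    seq_domain V s \<in> V_K_breadth V v \<delta>"
  unfolding V_K_breadth_def by blast

text \<open>Around its centre, each sequence can be replaced by one of the other kind without
  changing the ring, because the decisive filter \<open>nhds \<delta>\<close> admits radii from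
  either side. For a discrete value group both families are empty.\<close>

lemma V_div_breadth_eq_V_K_breadth:
  assumes "discrete_value_group v \<or> \<delta> \<notin> divisible_hull v"
  shows "V_div_breadth V v \<delta> = V_K_breadth V v \<delta>"
proof (cases "discrete_value_group v")
  case True
  then show ?thesis
    using V_div_breadth_discrete[OF assoc True] discrete_no_convergent_values[OF True]
    by (auto simp: V_K_breadth_def)
next
  case False
  then have dec: "decisive (nhds \<delta>)" using assms decisive_nhds by blast
  have le: "at_right \<delta> \<le> nhds \<delta>" by (simp add: at_within_def)
  show ?thesis
  proof (rule set_eqI, rule iffI)
    fix W assume "W \<in> V_div_breadth V v \<delta>"
    then obtain s where s: "pseudo_divergent v s" "breadth v s = ereal \<delta>" "W = seq_domain V s"
      by (auto simp: V_div_breadth_def)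
    obtain e where e: "\<And>a. pseudo_convergent v (\<lambda>n. a + e n)"
      "\<And>a. breadth v (\<lambda>n. a + e n) = ereal \<delta>" "\<And>a. pseudo_limit v (\<lambda>n. a + e n) a"
      using increasing_offsets[OF False] by metis
    have "W = seq_domain V (\<lambda>n. s 0 + e n)"
      unfolding s(3)
      using seq_domain_cong[OF dec approaches_mono[OF pseudo_divergent_approaches[OF s(1,2)] le]
          pseudo_limit_approaches[OF e]] .
    then show "W \<in> V_K_breadth V v \<delta>" using V_K_breadthI[OF e] by simp
  next
    fix W assume "W \<in> V_K_breadth V v \<delta>"
    then obtain s \<alpha> where s: "pseudo_convergent v s" "breadth v s = ereal \<delta>" "pseudo_limit v s \<alpha>"
      "W = seq_domain V s" by (auto simp: V_K_breadth_def)
    obtain e where e: "\<And>a. pseudo_divergent v (\<lambda>n. a + e n)"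
      "\<And>a. breadth v (\<lambda>n. a + e n) = ereal \<delta>" "\<And>a. approaches (\<lambda>n. a + e n) a (at_right \<delta>)"
      using decreasing_offsets[OF False] by metis
    have "W = seq_domain V (\<lambda>n. \<alpha> + e n)"
      unfolding s(4)
      using seq_domain_cong[OF dec pseudo_limit_approaches[OF s(1-3)] approaches_mono[OF e(3) le]] .
    then show "W \<in> V_div_breadth V v \<delta>" using V_div_breadthI[OF e(1,2)] by simp
  qed
qed

section \<open>Isolated points for a finite residue field\<close>

lemma V_div_breadth_subset_Zar: "V_div_breadth V v \<delta> \<subseteq> Zar V"
proof
  fix W assume "W \<in> V_div_breadth V v \<delta>"
  then obtain s where s: "pseudo_divergent v s" "breadth v s = ereal \<delta>" "W = seq_domain V s"
    by (auto simp: V_div_breadth_def)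
  show "W \<in> Zar V" unfolding s(3)
    by (rule seq_domain_in_Zar[OF decisive_at_right pseudo_divergent_approaches[OF s(1,2)]])
qed

text \<open>Serves to test whether a sequence eventually stays in the closed ball of radius \<delta>
  around \<open>a\<close>.\<close>

lemma linear_fract_in_seq_domain:
  assumes "v c = ereal \<delta>"
  shows "Fract [:-a, 1:] [:c:] \<in> seq_domain V x \<longleftrightarrow>
    (\<forall>\<^sub>F n in sequentially. ereal \<delta> \<le> v (x n - a))"
proof -
  have c: "c \<noteq> 0" using assms by (auto simp: v_0)
  have "(\<exists>y\<in>V. has_value_at (Fract [:-a, 1:] [:c:]) z y) \<longleftrightarrow> ereal \<delta> \<le> v (z - a)" for z
  proof -
    have "has_value_at (Fract [:-a, 1:] [:c:]) z ((z - a) / c)"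
      using has_value_at_Fract[of "[:c:]" z "[:-a, 1:]"] c by simp
    then have "(\<exists>y\<in>V. has_value_at (Fract [:-a, 1:] [:c:]) z y) \<longleftrightarrow> (z - a) / c \<in> V"
      by (rule has_value_at_Bex_iff)
    also have "\<dots> \<longleftrightarrow> ereal \<delta> \<le> v (z - a)"
    proof (cases "z = a")
      case False
      then obtain r where "v (z - a) = ereal r" using v_real[of "z - a"] by auto
      then show ?thesis using v_divide[OF _ assms] by (simp add: V_iff)
    qed (simp add: V_iff v_0)
    finally show ?thesis .
  qed
  then show ?thesis by (simp add: seq_domain_def)
qed

text \<open>Serves to test whether a sequence eventually avoids the open ball around
  \<open>a\<close>. The pole at \<open>a\<close> fits the equivalence, since no value exists there
  while \<open>v 0\<close> is infinite.\<close>

lemma inverse_linear_fract_in_seq_domain: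
  assumes "v c = ereal \<delta>"
  shows "Fract [:c:] [:-a, 1:] \<in> seq_domain V x \<longleftrightarrow>
    (\<forall>\<^sub>F n in sequentially. v (x n - a) \<le> ereal \<delta>)"
proof -
  have c: "c \<noteq> 0" using assms by (auto simp: v_0)
  have "(\<exists>y\<in>V. has_value_at (Fract [:c:] [:-a, 1:]) z y) \<longleftrightarrow> v (z - a) \<le> ereal \<delta>" for z
  proof (cases "z = a")
    case True
    have "\<not> has_value_at (Fract [:c:] [:-a, 1:]) a y" for y
      using has_value_at_FractD[of "[:c:]" "[:-a, 1:]" a y] c by auto
    then show ?thesis using True by (simp add: v_0)
  next
    case False
    then have "has_value_at (Fract [:c:] [:-a, 1:]) z (c / (z - a))"
      using has_value_at_Fract[of "[:-a, 1:]" z "[:c:]"] by simp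
    then have "(\<exists>y\<in>V. has_value_at (Fract [:c:] [:-a, 1:]) z y) \<longleftrightarrow> c / (z - a) \<in> V"
      by (rule has_value_at_Bex_iff)
    moreover obtain r where "v (z - a) = ereal r" using v_real[of "z - a"] False by auto
    ultimately show ?thesis using v_divide[OF assms] by (simp add: V_iff)
  qed
  then show ?thesis by (simp add: seq_domain_def)
qed

text \<open>The functions \<open>(X - a) / c\<close> and \<open>c / (X - a - c u)\<close>, with \<open>u\<close> running through
  representatives of the nonzero residue classes, confine the centre of a sequence to the open
  ball of radius \<open>\<delta>\<close> around \<open>a\<close>.\<close>

lemma V_div_breadth_isolated:
  assumes "\<delta> \<in> value_group v" "finite (residue_field V)" "W \<in> V_div_breadth V v \<delta>"
  obtains \<Phi> where "finite \<Phi>" "V_div_breadth V v \<delta> \<inter> {W' \<in> Zar V. \<Phi> \<subseteq> W'} = {W}"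
proof -
  obtain s where s: "pseudo_divergent v s" "breadth v s = ereal \<delta>" "W = seq_domain V s"
    using assms(3) by (auto simp: V_div_breadth_def)
  obtain c where c: "v c = ereal \<delta>" using assms(1) by (auto simp: value_group_def)
  have c0: "c \<noteq> 0" using c by (auto simp: v_0)
  obtain T where T: "T \<subseteq> V" "\<And>x. x \<in> V \<Longrightarrow> \<exists>t\<in>T. 0 < v (x - t)" "finite T"
    using residue_representatives assms(2) by metis
  define a where "a = s 0"
  have sa: "approaches s a (at_right \<delta>)"
    unfolding a_def by (rule pseudo_divergent_approaches[OF s(1,2)])
  define \<Phi> where "\<Phi> = insert (Fract [:-a, 1:] [:c:])
    ((\<lambda>u. Fract [:c:] [:-(a + c * u), 1:]) ` {u \<in> T. v u = 0})"
  have fin: "finite \<Phi>" using T(3) by (simp add: \<Phi>_def)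
  have gt: "\<forall>\<^sub>F n in sequentially. ereal \<delta> < v (s n - a)" by (rule approaches_at_right_gt[OF sa])
  have \<Phi>W: "\<Phi> \<subseteq> W"
  proof -
    have "Fract [:-a, 1:] [:c:] \<in> W"
      unfolding s(3) linear_fract_in_seq_domain[OF c]
      using gt by eventually_elim simp
    moreover have "Fract [:c:] [:-(a + c * u), 1:] \<in> W" if "v u = 0" for u
      unfolding s(3) inverse_linear_fract_in_seq_domain[OF c]
      using gt
    proof eventually_elim
      case (elim n)
      \<comment> \<open>\<open>c * u\<close> has value exactly \<delta>, less than
        \<open>v (s n - a)\<close>, so it determines the value of the difference.\<close>
      have "v (- (c * u)) = ereal \<delta>" using c that by (simp add: v_minus v_mult)
      then show ?case using v_add_eq[of "- (c * u)" "s n - a"] elim by (simp add: algebra_simps)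
    qed
    ultimately show ?thesis by (auto simp: \<Phi>_def)
  qed
  have uniq: "W' = W" if W': "W' \<in> V_div_breadth V v \<delta>" "\<Phi> \<subseteq> W'" for W'
  proof -
    obtain t where t: "pseudo_divergent v t" "breadth v t = ereal \<delta>" "W' = seq_domain V t"
      using W'(1) by (auto simp: V_div_breadth_def)
    define b where "b = t 0"
    have tb: "approaches t b (at_right \<delta>)"
      unfolding b_def by (rule pseudo_divergent_approaches[OF t(1,2)])
    note gt' = approaches_at_right_gt[OF tb]
    have "\<forall>\<^sub>F n in sequentially. ereal \<delta> \<le> v (t n - a)"
      using W'(2) linear_fract_in_seq_domain[OF c] unfolding t(3) \<Phi>_def by simp
    with gt' have "\<forall>\<^sub>F n in sequentially. ereal \<delta> \<le> v (b - a)"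
    proof eventually_elim
      case (elim n)
      then show ?case using v_ge_diff[of "ereal \<delta>" "t n - a" "t n - b"] by simp
    qed
    then have ba: "ereal \<delta> \<le> v (b - a)" by simp
    have "ereal \<delta> < v (b - a)"
    proof (rule ccontr)
      assume "\<not> ?thesis"
      then have eq: "v (b - a) = ereal \<delta>" using ba by simp
      then have v0: "v ((b - a) / c) = 0" using v_divide[OF eq c] by simp
      \<comment> \<open>A centre \<open>b\<close> at distance exactly \<delta> makes
        \<open>(b - a) / c\<close> a unit, whose class has a nonzero representative
        \<open>u\<close>. The function in \<Phi> for \<open>u\<close> excludes the open ball around
        \<open>a + c * u\<close>, which contains \<open>b\<close>.\<close>
      then obtain u where u: "u \<in> T" "0 < v ((b - a) / c - u)" using T(2)[of "(b - a) / c"] by (auto simp: V_iff)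
      have "v u = 0" using v_add_eq[of "(b - a) / c" "u - (b - a) / c"] u(2) v0
        by (simp add: v_minus_commute)
      then have le: "\<forall>\<^sub>F n in sequentially. v (t n - (a + c * u)) \<le> ereal \<delta>"
        using W'(2) u(1) unfolding inverse_linear_fract_in_seq_domain[OF c, symmetric] t(3) \<Phi>_def
        by blast
      have bu: "ereal \<delta> < v (b - (a + c * u))"
      proof -
        have "b - (a + c * u) = c * ((b - a) / c - u)" using c0 by (simp add: field_simps)
        then show ?thesis using u(2) c by (cases "v ((b - a) / c - u)") (auto simp: v_mult)
      qed
      from le gt' have "\<forall>\<^sub>F n in sequentially. False"
      proof eventually_elim
        case (elim n)
        have "(t n - b) + (b - (a + c * u)) = t n - (a + c * u)" by (simp add: algebra_simps)
        then show ?case using elim(1) v_gt_add[OF elim(2) bu] by (metis not_le)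
      qed
      then show False by simp
    qed
    then show ?thesis
      unfolding s(3) t(3)
      using seq_domain_cong[OF decisive_at_right approaches_recenter[OF tb] sa] by simp
  qed
  have "W \<in> Zar V" using assms(3) V_div_breadth_subset_Zar by blast
  have "V_div_breadth V v \<delta> \<inter> {W' \<in> Zar V. \<Phi> \<subseteq> W'} = {W}"
  proof
    show "{W} \<subseteq> V_div_breadth V v \<delta> \<inter> {W' \<in> Zar V. \<Phi> \<subseteq> W'}"
      using assms(3) \<Phi>W \<open>W \<in> Zar V\<close> by simp
    show "V_div_breadth V v \<delta> \<inter> {W' \<in> Zar V. \<Phi> \<subseteq> W'} \<subseteq> {W}"
    proof
      fix W' assume "W' \<in> V_div_breadth V v \<delta> \<inter> {W' \<in> Zar V. \<Phi> \<subseteq> W'}"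
      then show "W' \<in> {W}" using uniq[of W'] by simp
    qed
  qed
  then show thesis using that fin by blast
qed

end

section \<open>Neighbourhoods given by finite sets of functions\<close>

lemma openin_zariski_finite:
  assumes "finite \<Phi>"
  shows "openin (zariski_topology V) {W \<in> Zar V. \<Phi> \<subseteq> W}"
  using assms
proof (induction \<Phi>)
  case empty
  \<comment> \<open>Every valuation domain contains \<open>1\<close>, so the whole space is itself
    subbasic.\<close>
  have "{W \<in> Zar V. {} \<subseteq> W} = {W \<in> Zar V. 1 \<in> W}" by (auto simp: Zar_def valuation_domain_def)
  then show ?case unfolding zariski_topology_def by (auto intro!: topology_generated_by_Basis)
next
  case (insert \<phi> \<Phi>)
  have "openin (zariski_topology V) {W \<in> Zar V. \<phi> \<in> W}"
    unfolding zariski_topology_def by (auto intro!: topology_generated_by_Basis)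
  moreover have "{W \<in> Zar V. insert \<phi> \<Phi> \<subseteq> W} = {W \<in> Zar V. \<phi> \<in> W} \<inter> {W \<in> Zar V. \<Phi> \<subseteq> W}" by auto
  ultimately show ?case using insert by (simp add: openin_Int)
qed

lemma openin_constructible_finite:
  "finite \<Phi> \<Longrightarrow> openin (constructible_topology V) {W \<in> Zar V. \<Phi> \<subseteq> W}"
  unfolding constructible_topology_def by (rule topology_generated_by_Basis) blast

lemma topspace_zariski: "topspace (zariski_topology V) = Zar V"
proof
  show "topspace (zariski_topology V) \<subseteq> Zar V"
    by (auto simp: zariski_topology_def topology_generated_by_topspace)
  show "Zar V \<subseteq> topspace (zariski_topology V)"
    using openin_subset[OF openin_zariski_finite[of "{}"]] by simp
qed

lemma topspace_constructible: "topspace (constructible_topology V) = Zar V"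
proof
  show "topspace (constructible_topology V) \<subseteq> Zar V"
    by (auto simp: constructible_topology_def topology_generated_by_topspace)
  show "Zar V \<subseteq> topspace (constructible_topology V)"
    using openin_subset[OF openin_constructible_finite[of "{}"]] by simp
qed

text \<open>Sets given by finite \<Phi> form a base, because the union of two finite sets of
  functions describes the intersection of their neighbourhoods.\<close>

lemma zariski_neighbourhood:
  assumes "openin (zariski_topology V) U" "W \<in> U"
  obtains \<Phi> where "finite \<Phi>" "\<Phi> \<subseteq> W" "{W' \<in> Zar V. \<Phi> \<subseteq> W'} \<subseteq> U"
proof -
  have "generate_topology_on {{W \<in> Zar V. \<phi> \<in> W} |\<phi>. True} U"
    using assms(1) by (simp add: zariski_topology_def openin_topology_generated_by_iff)
  then have "\<exists>\<Phi>. finite \<Phi> \<and> \<Phi> \<subseteq> W \<and> {W' \<in> Zar V. \<Phi> \<subseteq> W'} \<subseteq> U" using assms(2)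
  proof (induction rule: generate_topology_on.induct)
    case Empty
    then show ?case by simp
  next
    case (Int A B)
    then obtain \<Phi> \<Psi> where "finite \<Phi> \<and> \<Phi> \<subseteq> W \<and> {W' \<in> Zar V. \<Phi> \<subseteq> W'} \<subseteq> A"
      "finite \<Psi> \<and> \<Psi> \<subseteq> W \<and> {W' \<in> Zar V. \<Psi> \<subseteq> W'} \<subseteq> B" by blast
    then show ?case by (intro exI[of _ "\<Phi> \<union> \<Psi>"]) auto
  next
    case (UN K)
    then obtain k where k: "k \<in> K" "W \<in> k" by blast
    from UN.IH[OF this] obtain \<Phi> where
      "finite \<Phi> \<and> \<Phi> \<subseteq> W \<and> {W' \<in> Zar V. \<Phi> \<subseteq> W'} \<subseteq> k" by blast
    with k(1) show ?case by (intro exI[of _ \<Phi>]) blast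
  next
    case (Basis S)
    then obtain \<phi> where "S = {W \<in> Zar V. \<phi> \<in> W}" by blast
    then show ?case using Basis by (intro exI[of _ "{\<phi>}"]) auto
  qed
  then show thesis using that by blast
qed

lemma discrete_subtopologyI:
  assumes "S \<subseteq> topspace X" "\<And>x. x \<in> S \<Longrightarrow> \<exists>U. openin X U \<and> S \<inter> U = {x}"
  shows "subtopology X S = discrete_topology S"
proof -
  have "openin (subtopology X S) {x}" if "x \<in> S" for x
    using assms(2)[OF that] by (metis openin_subtopology_Int2)
  then show ?thesis using assms(1)
    by (metis discrete_topology_unique topspace_subtopology_subset)
qed

section \<open>Synthetic division and reduction modulo the maximal ideal\<close>

text \<open>Division by \<open>X - u\<close>, evaluated at a point. It replaces factoring over the
  residue field, where the reduced polynomial is never formed.\<close>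

lemma synthetic_div_decomp:
  fixes p :: "'a::comm_ring poly"
  shows "poly p x = poly p u + (x - u) * poly (synthetic_div p u) x"
  using arg_cong[OF synthetic_div_correct[of p u], of "\<lambda>q. poly q x"]
  by (simp add: left_diff_distrib add_diff_eq eq_diff_eq)

lemma coeff_synthetic_div:
  fixes p :: "'a::comm_ring poly"
  shows "coeff p i = coeff (pCons (poly p u) (synthetic_div p u)) i - u * coeff (synthetic_div p u) i"
  using arg_cong[OF synthetic_div_correct[of p u], of "\<lambda>q. coeff q i"]
  by (simp add: eq_diff_eq)

context real_valuation
begin

lemma v_poly_nonneg:
  assumes "\<And>i. 0 \<le> v (coeff p i)" "0 \<le> v x"
  shows "0 \<le> v (poly p x)"
  using assms(1)
proof (induction p)
  case (pCons c p)
  have "0 \<le> v c" using pCons.prems[of 0] by simp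
  moreover have "0 \<le> v (coeff p i)" for i using pCons.prems[of "Suc i"] by simp
  ultimately show ?case using pCons.IH assms(2) by (simp add: v_ge_add v_mult_nonneg)
qed (simp add: v_0)

text \<open>The coefficients of the quotient are the Horner values at \<open>u\<close> of
  truncations of \<open>p\<close>, hence values of polynomials over \<open>V\<close> at a point of
  \<open>V\<close>.\<close>

lemma v_coeff_synthetic_div_nonneg:
  assumes "\<And>i. 0 \<le> v (coeff p i)" "0 \<le> v u"
  shows "0 \<le> v (coeff (synthetic_div p u) i)"
  using assms(1)
proof (induction p arbitrary: i)
  case (pCons c p)
  have p: "0 \<le> v (coeff p i)" for i using pCons.prems[of "Suc i"] by simp
  then show ?case using pCons.IH v_poly_nonneg[OF p assms(2)] by (simp add: coeff_pCons split: nat.split)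
qed (simp add: v_0)

text \<open>Modulo the maximal ideal, \<open>p(u) + (X - u) q\<close> vanishes if
  \<open>p(u)\<close> and \<open>q\<close> do. Read contrapositively, a unit coefficient of
  \<open>p\<close> yields one of \<open>q\<close> when \<open>u\<close> is a residue root.\<close>

lemma v_coeff_pos_from_synthetic_div:
  assumes "0 \<le> v u" "0 < v (poly p u)" "\<And>i. 0 < v (coeff (synthetic_div p u) i)"
  shows "0 < v (coeff p i)"
  unfolding coeff_synthetic_div[of p i u]
  using assms v_mult_pos[OF assms(3) assms(1)]
  by (intro v_gt_diff) (auto simp: coeff_pCons mult.commute split: nat.split)

text \<open>A unit coefficient makes the reduction nonzero, so it has finitely many roots. Division
  by \<open>X - u\<close> at a residue root \<open>u\<close> lowers the degree, keeps a unit
  coefficient and passes on every root \<open>t\<close> in another class, since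
  \<open>v (t - u) = 0\<close>.\<close>

lemma finite_residue_roots:
  assumes "T \<subseteq> V" "\<And>s t. s \<in> T \<Longrightarrow> t \<in> T \<Longrightarrow> s \<noteq> t \<Longrightarrow> v (s - t) = 0"
    and "\<And>i. 0 \<le> v (coeff p i)" "v (coeff p j) = 0"
  shows "finite {u \<in> T. 0 < v (poly p u)}"
  using assms(3,4)
proof (induction "degree p" arbitrary: p j rule: less_induct)
  case less
  show ?case
  proof (cases "{u \<in> T. 0 < v (poly p u)} = {}")
    case False
    then obtain u where u: "u \<in> T" "0 < v (poly p u)" by auto
    have uV: "0 \<le> v u" using u assms(1) by (auto simp: V_iff)
    let ?q = "synthetic_div p u"
    have q: "0 \<le> v (coeff ?q i)" for i by (rule v_coeff_synthetic_div_nonneg[OF less.prems(1) uV])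
    obtain i where i: "\<not> 0 < v (coeff ?q i)"
      using v_coeff_pos_from_synthetic_div[OF uV u(2), of j] less.prems(2) by auto
    then have "v (coeff ?q i) = 0" using q[of i] by simp
    \<comment> \<open>A constant \<open>p\<close> would have quotient \<open>0\<close>, whose
      coefficients all have infinite value, against the choice of \<open>i\<close>.\<close>
    moreover have "degree p \<noteq> 0"
      using i synthetic_div_eq_0_iff[of p u] by (auto simp: v_0)
    then have "degree ?q < degree p" by (simp add: degree_synthetic_div)
    ultimately have fin: "finite {t \<in> T. 0 < v (poly ?q t)}" using less.hyps q by blast
    have "{t \<in> T. 0 < v (poly p t)} \<subseteq> insert u {t \<in> T. 0 < v (poly ?q t)}"
    proof
      fix t assume "t \<in> {u \<in> T. 0 < v (poly p u)}"
      then have t: "t \<in> T" "0 < v (poly p t)" by auto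
      show "t \<in> insert u {t \<in> T. 0 < v (poly ?q t)}"
      proof (cases "t = u")
        case False
        then have "v (t - u) = 0" using assms(2) t(1) u(1) by blast
        moreover have "0 < v ((t - u) * poly ?q t)"
          using v_gt_diff[OF t(2) u(2)] synthetic_div_decomp[of p t u] by simp
        ultimately show ?thesis using t(1) by (simp add: v_mult)
      qed simp
    qed
    then show ?thesis using fin finite_subset by blast
  qed (metis finite.emptyI)
qed

text \<open>The \<open>y n\<close> lie in the residue class of \<open>u\<close> and move towards the
  boundary of that open ball. Division by \<open>X - u\<close> loses only
  \<open>v (y n - u)\<close>, which tends to \<open>0\<close>, so some positive lower bound survives
  until the degree is exhausted.\<close>

lemma v_coeff_pos_of_approaching_values:
  assumes "0 \<le> v u" "approaches y u (at_right 0)"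
    and "\<And>i. 0 \<le> v (coeff p i)"
    and "0 < m" "\<forall>\<^sub>F n in sequentially. ereal m \<le> v (poly p (y n))"
  shows "0 < v (coeff p i)"
  using assms(3-5)
proof (induction "degree p" arbitrary: p m i rule: less_induct)
  case less
  have pos: "\<forall>\<^sub>F n in sequentially. 0 < v (y n - u)"
    using approaches_at_right_gt[OF assms(2)] by (simp flip: zero_ereal_def)
  let ?q = "synthetic_div p u"
  have q: "0 \<le> v (coeff ?q i)" for i by (rule v_coeff_synthetic_div_nonneg[OF less.prems(1) assms(1)])
  have "\<forall>\<^sub>F n in sequentially. 0 < v (poly p u)"
    using pos less.prems(3)
  proof eventually_elim
    case (elim n)
    have "0 \<le> v (u + (y n - u))" using elim(1) assms(1) by (intro v_ge_add) auto
    then have "0 \<le> v (poly ?q (y n))" using v_poly_nonneg[OF q] by simp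
    then have "0 < v ((y n - u) * poly ?q (y n))" using elim by (intro v_mult_pos)
    moreover have "0 < v (poly p (y n))"
      using elim(2) less.prems(2) by (metis ereal_less(2) order_less_le_trans)
    ultimately show ?case using v_gt_diff synthetic_div_decomp[of p "y n" u]
      by (metis add_diff_cancel_right')
  qed
  then have pu: "0 < v (poly p u)" by simp
  show ?case
  proof (cases "degree p = 0")
    case True
    then have "?q = 0" by (simp add: synthetic_div_eq_0_iff)
    then show ?thesis using v_coeff_pos_from_synthetic_div[OF assms(1) pu] by (simp add: v_0)
  next
    case False
    then have deg: "degree ?q < degree p" by (simp add: degree_synthetic_div)
    \<comment> \<open>\<open>m'\<close> is also a lower bound for the value of \<open>p(u)\<close>,
      so subtracting \<open>p(u)\<close> preserves it.\<close>
    obtain m' where m': "0 < m'" "m' \<le> m" "ereal m' \<le> v (poly p u)"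
    proof (cases "v (poly p u)")
      case (real r)
      then show thesis using that[of "min m r"] pu less.prems(2) by auto
    qed (use that[of m] pu less.prems(2) in auto)
    \<comment> \<open>The factor \<open>y n - u\<close> accounts for less than
      \<open>m' / 2\<close>, leaving at least that much to the quotient.\<close>
    have small: "\<forall>\<^sub>F n in sequentially. \<exists>\<gamma>. v (y n - u) = ereal \<gamma> \<and> \<gamma> < m' / 2"
      using assms(2)
    proof (rule eventually_approaches)
      have "\<forall>\<^sub>F \<gamma> in at_right 0. \<gamma> < m' / 2"
        using m'(1) by (auto simp: eventually_at_right_field intro!: exI[of _ "m' / 2"])
      then show "\<forall>\<^sub>F \<gamma> in at_right 0. \<forall>z. v (z - u) = ereal \<gamma> \<longrightarrow>
          (\<exists>\<gamma>. v (z - u) = ereal \<gamma> \<and> \<gamma> < m' / 2)" by eventually_elim auto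
    qed
    have "\<forall>\<^sub>F n in sequentially. ereal (m' / 2) \<le> v (poly ?q (y n))"
      using small less.prems(3)
    proof eventually_elim
      case (elim n)
      then obtain \<gamma> where \<gamma>: "v (y n - u) = ereal \<gamma>" "\<gamma> < m' / 2" by auto
      have "ereal m' \<le> v (poly p (y n))" using elim(2) m'(2) by (meson ereal_less_eq(3) order_trans)
      then have "ereal m' \<le> v ((y n - u) * poly ?q (y n))"
        using v_ge_diff[OF _ m'(3)] synthetic_div_decomp[of p "y n" u]
        by (metis add_diff_cancel_left')
      then show ?case using \<gamma> by (cases "v (poly ?q (y n))") (auto simp: v_mult)
    qed
    then have "0 < v (coeff ?q i)" for i using less.hyps[OF deg q, of "m' / 2"] m'(1) by simp
    then show ?thesis by (rule v_coeff_pos_from_synthetic_div[OF assms(1) pu])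
  qed
qed

section \<open>Gauss valuations and residue classes\<close>

text \<open>A coefficient \<open>l\<close> of least value is factored out, so that
  \<open>v l\<close> is the Gauss valuation of \<open>p\<close>.\<close>

lemma primitive_part:
  assumes "p \<noteq> 0"
  obtains l P j where "l \<noteq> 0" "p = smult l P" "\<And>i. 0 \<le> v (coeff P i)" "v (coeff P j) = 0"
proof -
  define j where "j = arg_min_on (\<lambda>i. v (coeff p i)) {..degree p}"
  have min: "v (coeff p j) \<le> v (coeff p i)" if "i \<le> degree p" for i
    unfolding j_def using that by (intro arg_min_least) auto
  define l where "l = coeff p j"
  have "coeff p (degree p) \<noteq> 0" using assms by simp
  then have "v (coeff p (degree p)) \<noteq> \<infinity>" using v_eq_infinity by blast
  then have l0: "l \<noteq> 0" using min[of "degree p"] v_0 by (auto simp: l_def)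
  then obtain r where r: "v l = ereal r" using v_real by auto
  have c: "coeff (smult (1 / l) p) i = coeff p i / l" for i by simp
  show thesis
  proof (rule that[of l "smult (1 / l) p" j])
    show "l \<noteq> 0" by fact
    show "p = smult l (smult (1 / l) p)" using l0 by simp
    show "0 \<le> v (coeff (smult (1 / l) p) i)" for i
    proof (cases "coeff p i = 0")
      case False
      then have "i \<le> degree p" by (rule le_degree)
      moreover obtain t where "v (coeff p i) = ereal t" using False v_real by auto
      ultimately show ?thesis unfolding c using min[of i] r v_divide[OF _ r] by (simp add: l_def)
    qed (simp add: v_0)
    show "v (coeff (smult (1 / l) p) j) = 0" unfolding c using l0 v_1 by (simp add: l_def)
  qed
qed

text \<open>The substitution of \<open>c X\<close> carries the closed unit ball to the closed ball
  of radius \<open>v c\<close> around \<open>0\<close>, so \<open>v l\<close> is the Gauss valuation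
  of \<open>p\<close> on that ball.\<close>

lemma primitive_part_scaled:
  assumes "p \<noteq> 0" "c \<noteq> 0"
  obtains l P j where "l \<noteq> 0" "\<And>y. poly p (c * y) = l * poly P y"
    "\<And>i. 0 \<le> v (coeff P i)" "v (coeff P j) = 0"
proof -
  have "pcompose p [:0, c:] \<noteq> 0" using assms by (simp add: pcompose_eq_0_iff)
  then obtain l P j where P: "l \<noteq> 0" "pcompose p [:0, c:] = smult l P"
    "\<And>i. 0 \<le> v (coeff P i)" "v (coeff P j) = 0" using primitive_part by metis
  have "poly p (c * y) = l * poly P y" for y
    using arg_cong[OF P(2), of "\<lambda>q. poly q y"] by (simp add: poly_pcompose mult.commute)
  then show thesis using that P by blast
qed

text \<open>\<open>p(y)\<close> and \<open>p(u)\<close> agree modulo the maximal ideal, and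
  \<open>p(u)\<close> is a unit.\<close>

lemma v_poly_residue:
  assumes "\<And>i. 0 \<le> v (coeff p i)" "0 \<le> v u" "0 < v (y - u)" "\<not> 0 < v (poly p u)"
  shows "v (poly p y) = 0"
proof -
  have "0 \<le> v (u + (y - u))" using assms by (intro v_ge_add) auto
  then have "0 < v ((y - u) * poly (synthetic_div p u) y)"
    using v_poly_nonneg[OF v_coeff_synthetic_div_nonneg[OF assms(1,2)]] assms(3)
    by (intro v_mult_pos) auto
  moreover have "v (poly p u) = 0" using v_poly_nonneg[OF assms(1,2)] assms(4) by simp
  ultimately show ?thesis using v_add_eq[of "poly p u"] synthetic_div_decomp[of p y u] by simp
qed

text \<open>Both the hypothesis at \<open>u\<^sub>0\<close> and the conclusion amount to nonnegativity of the Gauss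
  valuation of \<open>\<phi>\<close> on the closed ball of radius \<open>\<delta>\<close>, which is \<open>v l - v l'\<close> below.\<close>

lemma cofinite_residues:
  assumes c: "v c = ereal \<delta>" and e: "approaches e 0 (at_right \<delta>)"
    and T: "T \<subseteq> V" "\<And>s t. s \<in> T \<Longrightarrow> t \<in> T \<Longrightarrow> s \<noteq> t \<Longrightarrow> v (s - t) = 0"
    and u0: "u\<^sub>0 \<in> V" "\<phi> \<in> seq_domain V (\<lambda>n. c * u\<^sub>0 + e n)"
  shows "finite {u \<in> T. \<phi> \<notin> seq_domain V (\<lambda>n. c * u + e n)}"
proof -
  have c0: "c \<noteq> 0" using c by (auto simp: v_0)
  \<comment> \<open>Division by \<open>c\<close>, of value \<delta>, turns radii tending to \<delta>
    into radii tending to \<open>0\<close> and the centre \<open>c * u\<close> into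
    \<open>u\<close>.\<close>
  have ec: "approaches (\<lambda>n. u + e n / c) u (at_right 0)" for u
  proof -
    obtain \<gamma> where \<gamma>: "\<forall>\<^sub>F n in sequentially. v (e n - 0) = ereal (\<gamma> n)"
      "filterlim \<gamma> (at_right \<delta>) sequentially" using e by (auto simp: approaches_def)
    have "\<forall>\<^sub>F n in sequentially. v (u + e n / c - u) = ereal (\<gamma> n - \<delta>)"
      using \<gamma>(1) by eventually_elim (use v_divide[OF _ c] in simp)
    moreover have "filterlim (\<lambda>n. \<gamma> n - \<delta>) (at_right 0) sequentially"
    proof -
      have "\<gamma> \<longlonglongrightarrow> \<delta>" "\<forall>\<^sub>F n in sequentially. \<delta> < \<gamma> n" using \<gamma>(2)
        by (auto simp: filterlim_at elim: eventually_mono)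
      then show ?thesis
        by (auto simp: filterlim_at LIM_zero_iff elim: eventually_mono)
    qed
    ultimately show ?thesis by (auto simp: approaches_def intro!: exI[of _ "\<lambda>n. \<gamma> n - \<delta>"])
  qed
  have pos: "\<forall>\<^sub>F n in sequentially. 0 < v (u + e n / c - u)" for u
    using approaches_at_right_gt[OF ec[of u]] by (simp flip: zero_ereal_def)
  have arg: "c * u + e n = c * (u + e n / c)" for u n using c0 by (simp add: field_simps)
  obtain p q where \<phi>: "\<phi> = Fract p q" "q \<noteq> 0" by (cases \<phi>)
  show ?thesis
  proof (cases "p = 0")
    case True
    have "\<exists>y\<in>V. has_value_at \<phi> x y" for x
      using has_value_at_const[of 0 x] \<phi> True
      by (intro bexI[of _ 0]) (simp_all add: fract_collapse to_fract_def V_iff v_0)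
    then have "\<phi> \<in> seq_domain V x" for x by (simp add: seq_domain_def)
    then show ?thesis by simp
  next
    case False
    obtain l P j where P: "l \<noteq> 0" "\<And>y. poly p (c * y) = l * poly P y"
      "\<And>i. 0 \<le> v (coeff P i)" "v (coeff P j) = 0" using primitive_part_scaled[OF False c0] by metis
    obtain l' Q j' where Q: "l' \<noteq> 0" "\<And>y. poly q (c * y) = l' * poly Q y"
      "\<And>i. 0 \<le> v (coeff Q i)" "v (coeff Q j') = 0" using primitive_part_scaled[OF \<phi>(2) c0] by metis
    obtain r where r: "v l = ereal r" using P(1) v_real by auto
    obtain r' where r': "v l' = ereal r'" using Q(1) v_real by auto
    \<comment> \<open>Otherwise \<open>P\<close> would keep value at least \<open>r' - r > 0\<close>
      towards the boundary of the residue class of \<open>u\<^sub>0\<close>, and all its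
      coefficients would lie in the maximal ideal, although one is a unit.\<close>
    have "r' \<le> r"
    proof (rule ccontr)
      assume "\<not> r' \<le> r"
      then have m: "0 < r' - r" by simp
      have u0V: "0 \<le> v u\<^sub>0" using u0(1) V_iff by simp
      have "\<forall>\<^sub>F n in sequentially. \<exists>y\<in>V. has_value_at \<phi> (c * u\<^sub>0 + e n) y"
        using u0(2) by (simp add: seq_domain_def)
      with pos[of u\<^sub>0]
      have "\<forall>\<^sub>F n in sequentially. ereal (r' - r) \<le> v (poly P (u\<^sub>0 + e n / c))"
      proof eventually_elim
        case (elim n)
        let ?y = "u\<^sub>0 + e n / c"
        obtain z where z: "z \<in> V" "has_value_at \<phi> (c * ?y) z" using elim(2) unfolding arg by auto
        have "l * poly P ?y = z * (l' * poly Q ?y)"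
          using has_value_at_FractD[of p q "c * ?y" z] z(2) \<phi> P(2) Q(2) by simp
        then have eq: "ereal r + v (poly P ?y) = v z + (ereal r' + v (poly Q ?y))"
          using r r' by (metis v_mult)
        have "0 \<le> v (u\<^sub>0 + (?y - u\<^sub>0))" using u0V elim(1) by (intro v_ge_add) auto
        then have "0 \<le> v (poly Q ?y)" using v_poly_nonneg[OF Q(3)] by simp
        then show ?case using eq z(1)[unfolded V_iff]
          by (cases "v (poly P ?y)"; cases "v z"; cases "v (poly Q ?y)") auto
      qed
      from v_coeff_pos_of_approaching_values[OF u0V ec P(3) m this, of j] P(4) show False by simp
    qed
    \<comment> \<open>Off the residue roots of \<open>P\<close> and \<open>Q\<close> both take unit
      values, so \<phi> has valuation exactly \<open>r - r'\<close>.\<close>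
    have good: "\<phi> \<in> seq_domain V (\<lambda>n. c * u + e n)"
      if u: "u \<in> T" "\<not> 0 < v (poly P u)" "\<not> 0 < v (poly Q u)" for u
    proof -
      have uV: "0 \<le> v u" using u T(1) by (auto simp: V_iff)
      have "\<forall>\<^sub>F n in sequentially. \<exists>y\<in>V. has_value_at \<phi> (c * u + e n) y"
        using pos[of u]
      proof eventually_elim
        case (elim n)
        let ?x = "c * u + e n"
        have "v (poly P (u + e n / c)) = 0" "v (poly Q (u + e n / c)) = 0"
          using v_poly_residue[OF P(3) uV elim u(2)] v_poly_residue[OF Q(3) uV elim u(3)] by auto
        then have px: "v (poly p ?x) = ereal r" and qx: "v (poly q ?x) = ereal r'"
          unfolding arg by (simp_all add: P(2) Q(2) v_mult r r')
        have "poly q ?x \<noteq> 0" using qx by (auto simp: v_0)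
        then have "has_value_at \<phi> ?x (poly p ?x / poly q ?x)" unfolding \<phi>(1) by (rule has_value_at_Fract)
        moreover have "poly p ?x / poly q ?x \<in> V"
          using v_divide[OF px qx] \<open>r' \<le> r\<close> by (simp add: V_iff)
        ultimately show ?case by blast
      qed
      then show ?thesis by (simp add: seq_domain_def)
    qed
    have "{u \<in> T. \<phi> \<notin> seq_domain V (\<lambda>n. c * u + e n)} \<subseteq>
        {u \<in> T. 0 < v (poly P u)} \<union> {u \<in> T. 0 < v (poly Q u)}" using good by blast
    then show ?thesis
      using finite_residue_roots[OF T P(3,4)] finite_residue_roots[OF T Q(3,4)]
      by (meson finite_UnI finite_subset)
  qed
qed

section \<open>Failure of the Hausdorff property for an infinite residue field\<close>

lemma V_div_breadth_not_Hausdorff: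
  assumes "\<delta> \<in> value_group v" "infinite (residue_field V)" "\<not> discrete_value_group v"
  shows "\<not> Hausdorff_space (subtopology (zariski_topology V) (V_div_breadth V v \<delta>))"
proof
  let ?D = "V_div_breadth V v \<delta>"
  let ?X = "subtopology (zariski_topology V) ?D"
  assume H: "Hausdorff_space ?X"
  obtain c where c: "v c = ereal \<delta>" using assms(1) by (auto simp: value_group_def)
  obtain T where T: "T \<subseteq> V" "\<And>s t. s \<in> T \<Longrightarrow> t \<in> T \<Longrightarrow> s \<noteq> t \<Longrightarrow> v (s - t) = 0" "infinite T"
    using residue_representatives assms(2) by metis
  obtain e where e: "\<And>a. pseudo_divergent v (\<lambda>n. a + e n)"
    "\<And>a. breadth v (\<lambda>n. a + e n) = ereal \<delta>" "\<And>a. approaches (\<lambda>n. a + e n) a (at_right \<delta>)"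
    using decreasing_offsets[OF assms(3)] by metis
  \<comment> \<open>\<open>W u\<close> is the ring of the open ball of radius \<delta> around
    \<open>c * u\<close>; distinct representatives give disjoint balls inside one closed
    ball.\<close>
  define W where "W = (\<lambda>u. seq_domain V (\<lambda>n. c * u + e n))"
  have WD: "W u \<in> ?D" for u unfolding W_def by (rule V_div_breadthI[OF e(1,2)])
  have top: "topspace ?X = ?D"
    using V_div_breadth_subset_Zar by (simp add: topspace_zariski inf.absorb2)
  have e0: "approaches e 0 (at_right \<delta>)" using e(3)[of 0] by simp
  obtain s where s: "s \<in> T" using T(3) by fastforce
  obtain t where t: "t \<in> T" "t \<noteq> s" using T(3) by (metis finite.simps infinite_imp_nonempty insertCI subsetI finite_subset singleton_iff)
  have gt: "\<forall>\<^sub>F n in sequentially. ereal \<delta> < v (c * u + e n - c * u)" for u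
    using approaches_at_right_gt[OF e(3)[of "c * u"]] .
  \<comment> \<open>This function separates the two rings: it leaves \<open>V\<close> on the open
    ball around \<open>c * s\<close> and stays in \<open>V\<close> on the one around
    \<open>c * t\<close>.\<close>
  have "Fract [:c:] [:-(c * s), 1:] \<notin> W s"
  proof
    assume "Fract [:c:] [:-(c * s), 1:] \<in> W s"
    then have "\<forall>\<^sub>F n in sequentially. v (c * s + e n - c * s) \<le> ereal \<delta>"
      unfolding W_def inverse_linear_fract_in_seq_domain[OF c] .
    with gt[of s] have "\<forall>\<^sub>F n in sequentially. False" by eventually_elim simp
    then show False by simp
  qed
  moreover have "Fract [:c:] [:-(c * s), 1:] \<in> W t"
    unfolding W_def inverse_linear_fract_in_seq_domain[OF c]
    using gt[of t]
  proof eventually_elim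
    case (elim n)
    have "v (c * (t - s)) = ereal \<delta>" using T(2)[OF t(1) s t(2)] c by (simp add: v_mult)
    then show ?case using v_add_eq[of "c * (t - s)" "e n"] elim by (simp add: algebra_simps)
  qed
  ultimately have "W s \<noteq> W t" by auto
  then obtain A B where AB: "openin ?X A" "openin ?X B" "W s \<in> A" "W t \<in> B" "disjnt A B"
    using H WD top unfolding Hausdorff_space_def by metis
  obtain A' B' where A': "openin (zariski_topology V) A'" "A = A' \<inter> ?D"
    and B': "openin (zariski_topology V) B'" "B = B' \<inter> ?D"
    using AB(1,2) by (auto simp: openin_subtopology)
  obtain \<Phi> where \<Phi>: "finite \<Phi>" "\<Phi> \<subseteq> W s" "{W' \<in> Zar V. \<Phi> \<subseteq> W'} \<subseteq> A'"
    using zariski_neighbourhood[OF A'(1)] AB(3) A'(2) by blast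
  obtain \<Psi> where \<Psi>: "finite \<Psi>" "\<Psi> \<subseteq> W t" "{W' \<in> Zar V. \<Psi> \<subseteq> W'} \<subseteq> B'"
    using zariski_neighbourhood[OF B'(1)] AB(4) B'(2) by blast
  have cof: "finite {u \<in> T. \<phi> \<notin> W u}" if "\<phi> \<in> W s \<or> \<phi> \<in> W t" for \<phi>
    using that cofinite_residues[OF c e0 T(1,2), of _ \<phi>] s t(1) T(1) unfolding W_def by blast
  \<comment> \<open>The finitely many functions describing both neighbourhoods exclude only finitely
    many representatives in total, so some \<open>W u\<close> lies in both.\<close>
  have "finite (\<Union>\<phi>\<in>\<Phi> \<union> \<Psi>. {u \<in> T. \<phi> \<notin> W u})"
    using \<Phi>(1,2) \<Psi>(1,2) cof by auto
  then have "T - (\<Union>\<phi>\<in>\<Phi> \<union> \<Psi>. {u \<in> T. \<phi> \<notin> W u}) \<noteq> {}"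
    using T(3) by (intro infinite_imp_nonempty Diff_infinite_finite)
  then obtain u where "u \<in> T - (\<Union>\<phi>\<in>\<Phi> \<union> \<Psi>. {u \<in> T. \<phi> \<notin> W u})"
    unfolding ex_in_conv[symmetric] by (elim exE)
  then have u: "\<Phi> \<subseteq> W u" "\<Psi> \<subseteq> W u" by auto
  have "W u \<in> Zar V" using WD V_div_breadth_subset_Zar by blast
  then have "W u \<in> A'" "W u \<in> B'" using u \<Phi>(3) \<Psi>(3) by auto
  then have "W u \<in> A \<inter> B" using A'(2) B'(2) WD[of u] by simp
  then show False using AB(5) unfolding disjnt_def by (metis empty_iff)
qed

end

text \<open>If the value group is nondiscrete and its divisible hull contains \<delta>, the two
  families are disjoint and the first is nonempty, whence the condition for equality. A discrete
  value group makes \<open>V_div_breadth V v \<delta>\<close> empty and so Hausdorff.\<close>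

theorem proposition5p4:
  fixes V :: "'k::field set" and v :: "'k \<Rightarrow> ereal" and \<delta> :: real
  assumes "valuation_domain V" and "rank_one V" and "associated_valuation V v"
  shows
    "(\<delta> \<notin> value_group v \<and> (discrete_value_group v \<or> \<delta> \<notin> divisible_hull v) \<longrightarrow>
        V_div_breadth V v \<delta> = V_K_breadth V v \<delta>) \<and>
     (\<delta> \<in> value_group v \<and> finite (residue_field V) \<longrightarrow>
        subtopology (zariski_topology V) (V_div_breadth V v \<delta>)
          = discrete_topology (V_div_breadth V v \<delta>) \<and>
        subtopology (constructible_topology V) (V_div_breadth V v \<delta>)
          = discrete_topology (V_div_breadth V v \<delta>)) \<and>
     (\<delta> \<in> value_group v \<and> infinite (residue_field V) \<and> \<not> discrete_value_group v \<longrightarrow>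
        \<not> Hausdorff_space (subtopology (zariski_topology V) (V_div_breadth V v \<delta>))) \<and>
     (infinite (residue_field V) \<and> \<not> discrete_value_group v \<longrightarrow>
        \<not> Hausdorff_space (subtopology (zariski_topology V) (V_div V v)))"
proof -
  interpret real_valuation V v by unfold_locales (fact assms(3))
  show ?thesis
  proof (intro conjI impI)
    assume "\<delta> \<notin> value_group v \<and> (discrete_value_group v \<or> \<delta> \<notin> divisible_hull v)"
    then show "V_div_breadth V v \<delta> = V_K_breadth V v \<delta>" using V_div_breadth_eq_V_K_breadth by blast
  next
    assume b: "\<delta> \<in> value_group v \<and> finite (residue_field V)"
    have iso: "\<exists>\<Phi>. finite \<Phi> \<and> V_div_breadth V v \<delta> \<inter> {W' \<in> Zar V. \<Phi> \<subseteq> W'} = {W}"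
      if "W \<in> V_div_breadth V v \<delta>" for W
      using V_div_breadth_isolated[OF _ _ that] b by metis
    show "subtopology (zariski_topology V) (V_div_breadth V v \<delta>)
        = discrete_topology (V_div_breadth V v \<delta>)"
    proof (rule discrete_subtopologyI)
      show "V_div_breadth V v \<delta> \<subseteq> topspace (zariski_topology V)"
        unfolding topspace_zariski by (rule V_div_breadth_subset_Zar)
      show "\<exists>U. openin (zariski_topology V) U \<and> V_div_breadth V v \<delta> \<inter> U = {W}"
        if "W \<in> V_div_breadth V v \<delta>" for W
        using iso[OF that] openin_zariski_finite by metis
    qed
    show "subtopology (constructible_topology V) (V_div_breadth V v \<delta>)
        = discrete_topology (V_div_breadth V v \<delta>)"
    proof (rule discrete_subtopologyI)
      show "V_div_breadth V v \<delta> \<subseteq> topspace (constructible_topology V)"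
        unfolding topspace_constructible by (rule V_div_breadth_subset_Zar)
      show "\<exists>U. openin (constructible_topology V) U \<and> V_div_breadth V v \<delta> \<inter> U = {W}"
        if "W \<in> V_div_breadth V v \<delta>" for W
        using iso[OF that] openin_constructible_finite by metis
    qed
  next
    assume "\<delta> \<in> value_group v \<and> infinite (residue_field V) \<and> \<not> discrete_value_group v"
    then show "\<not> Hausdorff_space (subtopology (zariski_topology V) (V_div_breadth V v \<delta>))"
      using V_div_breadth_not_Hausdorff by blast
  next
    assume "infinite (residue_field V) \<and> \<not> discrete_value_group v"
    \<comment> \<open>Every value group contains \<open>0\<close>, and the Hausdorff property passes
      to subspaces, so breadth \<open>0\<close> decides the matter for all of
      \<open>V_div V v\<close>.\<close>
    then have "\<not> Hausdorff_space (subtopology (zariski_topology V) (V_div_breadth V v 0))"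
      using V_div_breadth_not_Hausdorff value_group_0 by blast
    moreover have "V_div V v \<inter> V_div_breadth V v 0 = V_div_breadth V v 0"
      by (auto simp: V_div_def V_div_breadth_def)
    ultimately show "\<not> Hausdorff_space (subtopology (zariski_topology V) (V_div V v))"
      using Hausdorff_space_subtopology[of "subtopology (zariski_topology V) (V_div V v)"
          "V_div_breadth V v 0"]
      by (auto simp: subtopology_subtopology)
  qed
qed

end
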